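(* Fix $\theta\in(0,\pi/4]$ and let the Bank distribute $|W\rangle_{A'B'K}=\alpha|001\rangle+\beta|010\rangle+\gamma|100\rangle$ with real $\alpha,\beta,\gamma>0$, $\alpha^2+\beta^2+\gamma^2=1$, in addition to the link $|\psi(\theta)\rangle_{AB}=\cos\theta|00\rangle+\sin\theta|11\rangle$ shared by Alice and Bob. In the Bank-measures model, Alice and Bob can deterministically restore a Bell pair on $AB$ by LOCC if and only if $$4\beta^2\gamma^2\ge 1-\tan^4\theta.$$
   Context: All registers $A,B,A',B',K$ are qubits; in $|W\rangle_{A'B'K}$ the tensor factors are ordered $A',B',K$. The global initial state is $|\psi(\theta)\rangle_{AB}\otimes|W\rangle_{A'B'K}$. Alice holds $A,A'$; Bob holds $B,B'$; the Bank holds $K$. LOCC means local quantum operations by Alice and Bob (local ancillas and discarding of systems allowed) with finitely many rounds of classical communication between them. Bank-measures model: the Bank performs a quantum measurement on $K$ (of its choice) and broadcasts the classical outcome; afterwards Alice (on $AA'$) and Bob (on $BB'$) act by LOCC, which may depend on the outcome; the Bank does nothing else. Deterministic restoration of a Bell pair on $AB$ means that, with probability one (in every measurement branch), the final state of the registers $A$ and $B$ is exactly $|\Phi^+\rangle=\frac{1}{\sqrt2}(|00\rangle+|11\rangle)$; other registers may be left in any state or discarded. *)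

theory Defs
  imports Complex_Main "Jordan_Normal_Form.Schur_Decomposition"
begin

section \<open>Linear algebra for composite systems\<close>

text \<open>Kets are column matrices, operators and density matrices are elements of
  \<open>complex mat\<close>.  The basis vector \<open>|i\<^sub>1, i\<^sub>2\<rangle>\<close> of a tensor product with second factor of dimension
  \<open>d\<close> has index \<open>i\<^sub>1 * d + i\<^sub>2\<close>.\<close>

definition kron :: "complex mat \<Rightarrow> complex mat \<Rightarrow> complex mat" (infixr "\<otimes>\<^sub>m" 75) where
  "A \<otimes>\<^sub>m B = mat (dim_row A * dim_row B) (dim_col A * dim_col B)
     (\<lambda>(i, j). A $$ (i div dim_row B, j div dim_col B) * B $$ (i mod dim_row B, j mod dim_col B))"

definition ket :: "nat \<Rightarrow> complex mat" where
  "ket i = mat 2 1 (\<lambda>(r, _). if r = i then 1 else 0)"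

definition density :: "complex mat \<Rightarrow> complex mat" where
  "density v = v * mat_adjoint v"

definition mat_trace :: "complex mat \<Rightarrow> complex" where
  "mat_trace A = (\<Sum>i<dim_row A. A $$ (i, i))"

definition mat_sum :: "nat \<Rightarrow> complex mat list \<Rightarrow> complex mat" where
  "mat_sum d As = foldr (+) As (0\<^sub>m d d)"

definition ptrace_snd :: "nat \<Rightarrow> nat \<Rightarrow> complex mat \<Rightarrow> complex mat" where
  "ptrace_snd d e \<rho> = mat d d (\<lambda>(i, j). \<Sum>k<e. \<rho> $$ (i * e + k, j * e + k))"

definition swap_qubits :: "complex mat" where
  "swap_qubits = mat 4 4 (\<lambda>(i, j). if i div 2 = j mod 2 \<and> i mod 2 = j div 2 then 1 else 0)"

section \<open>Quantum operations and measurements\<close>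

text \<open>Kraus maps act on unnormalised states: the trace of the state of a branch is the
  probability of that branch.\<close>

definition kraus_map :: "nat \<Rightarrow> complex mat list \<Rightarrow> complex mat \<Rightarrow> complex mat" where
  "kraus_map d Ks \<rho> = mat_sum d (map (\<lambda>K. K * \<rho> * mat_adjoint K) Ks)"

text \<open>Entry number \<open>j\<close> of an instrument is the output dimension and the list of Kraus operators for
  outcome \<open>j\<close>.  Several Kraus operators for one outcome model discarded information (in particular
  discarded subsystems); changes of dimension cover local ancillas and discarding.\<close>

type_synonym instrument = "(nat \<times> complex mat list) list"

definition is_instrument :: "nat \<Rightarrow> instrument \<Rightarrow> bool" where
  "is_instrument d I \<longleftrightarrow>
     (\<forall>(d', Ks) \<in> set I. \<forall>K \<in> set Ks. K \<in> carrier_mat d' d) \<and>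
     mat_sum d (concat (map (\<lambda>(d', Ks). map (\<lambda>K. mat_adjoint K * K) Ks) I)) = 1\<^sub>m d"

definition is_measurement :: "nat \<Rightarrow> complex mat list \<Rightarrow> bool" where
  "is_measurement d Ms \<longleftrightarrow>
     (\<forall>M \<in> set Ms. M \<in> carrier_mat d d) \<and> mat_sum d (map (\<lambda>M. mat_adjoint M * M) Ms) = 1\<^sub>m d"

section \<open>LOCC protocols\<close>

text \<open>In each round one party applies an instrument and announces the outcome \<open>j\<close>; the protocol
  continues with the \<open>j\<close>-th continuation, so every later operation may depend on the whole history.
  Only the finitely many continuations with \<open>j < length I\<close> are ever used, hence the tree of possible
  histories is finite.\<close>

datatype locc =
    Done
  | Alice instrument "nat \<Rightarrow> locc"
  | Bob instrument "nat \<Rightarrow> locc"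

primrec locc_valid :: "locc \<Rightarrow> nat \<Rightarrow> nat \<Rightarrow> bool" where
  "locc_valid Done dA dB \<longleftrightarrow> True"
| "locc_valid (Alice I P) dA dB \<longleftrightarrow>
     is_instrument dA I \<and> (\<forall>j<length I. locc_valid (P j) (fst (I ! j)) dB)"
| "locc_valid (Bob I P) dA dB \<longleftrightarrow>
     is_instrument dB I \<and> (\<forall>j<length I. locc_valid (P j) dA (fst (I ! j)))"

text \<open>The final branches \<open>(dA, dB, \<sigma>)\<close>: local dimensions of Alice and Bob and the unnormalised
  joint state.\<close>

primrec locc_branches ::
    "locc \<Rightarrow> nat \<Rightarrow> nat \<Rightarrow> complex mat \<Rightarrow> (nat \<times> nat \<times> complex mat) set" where
  "locc_branches Done dA dB \<rho> = {(dA, dB, \<rho>)}"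
| "locc_branches (Alice I P) dA dB \<rho> =
     (\<Union>j<length I. locc_branches (P j) (fst (I ! j)) dB
        (kraus_map (fst (I ! j) * dB) (map (\<lambda>K. K \<otimes>\<^sub>m 1\<^sub>m dB) (snd (I ! j))) \<rho>))"
| "locc_branches (Bob I P) dA dB \<rho> =
     (\<Union>j<length I. locc_branches (P j) dA (fst (I ! j))
        (kraus_map (dA * fst (I ! j)) (map (\<lambda>K. 1\<^sub>m dA \<otimes>\<^sub>m K) (snd (I ! j))) \<rho>))"

section \<open>States and the Bank-measures model\<close>

definition link_state :: "real \<Rightarrow> complex mat" where
  "link_state \<theta> = complex_of_real (cos \<theta>) \<cdot>\<^sub>m (ket 0 \<otimes>\<^sub>m ket 0)
                + complex_of_real (sin \<theta>) \<cdot>\<^sub>m (ket 1 \<otimes>\<^sub>m ket 1)"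

definition W_state :: "real \<Rightarrow> real \<Rightarrow> real \<Rightarrow> complex mat" where
  "W_state \<alpha> \<beta> \<gamma> = complex_of_real \<alpha> \<cdot>\<^sub>m (ket 0 \<otimes>\<^sub>m ket 0 \<otimes>\<^sub>m ket 1)
                  + complex_of_real \<beta> \<cdot>\<^sub>m (ket 0 \<otimes>\<^sub>m ket 1 \<otimes>\<^sub>m ket 0)
                  + complex_of_real \<gamma> \<cdot>\<^sub>m (ket 1 \<otimes>\<^sub>m ket 0 \<otimes>\<^sub>m ket 0)"

definition bell_state :: "complex mat" where
  "bell_state = complex_of_real (1 / sqrt 2) \<cdot>\<^sub>m (ket 0 \<otimes>\<^sub>m ket 0 + ket 1 \<otimes>\<^sub>m ket 1)"

text \<open>A state on \<open>A B\<close> tensored with a state on \<open>A' B' K\<close>, with the factors reordered to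
  \<open>A A' B B' K\<close> so that Alice's and Bob's registers are adjacent.\<close>

definition global_state :: "complex mat \<Rightarrow> complex mat \<Rightarrow> complex mat" where
  "global_state \<psi> w = (1\<^sub>m 2 \<otimes>\<^sub>m swap_qubits \<otimes>\<^sub>m 1\<^sub>m 4) * (\<psi> \<otimes>\<^sub>m w)"

text \<open>Unnormalised state of \<open>A A' B B'\<close> after the Bank obtains the outcome of the measurement
  operator \<open>M\<close> on \<open>K\<close>.\<close>

definition bank_outcome_state :: "complex mat \<Rightarrow> complex mat \<Rightarrow> complex mat" where
  "bank_outcome_state M \<rho> = ptrace_snd 16 2 (kraus_map 32 [1\<^sub>m 16 \<otimes>\<^sub>m M] \<rho>)"

text \<open>Reduced state of the registers \<open>A\<close> and \<open>B\<close> when Alice holds \<open>A\<close> (first) and a system of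
  dimension \<open>m\<close>, and Bob holds \<open>B\<close> (first) and a system of dimension \<open>n\<close>.\<close>

definition reduced_AB :: "nat \<Rightarrow> nat \<Rightarrow> complex mat \<Rightarrow> complex mat" where
  "reduced_AB m n \<sigma> = mat 4 4 (\<lambda>(i, j). \<Sum>r<m. \<Sum>s<n.
     \<sigma> $$ ((i div 2 * m + r) * (2 * n) + (i mod 2 * n + s),
            (j div 2 * m + r) * (2 * n) + (j mod 2 * n + s)))"

text \<open>In every branch of nonzero probability, the normalised state of \<open>A B\<close> is the Bell state;
  the other local systems may have any dimension and be in any state.\<close>

definition restores_bell :: "locc \<Rightarrow> complex mat \<Rightarrow> bool" where
  "restores_bell P \<rho> \<longleftrightarrow>
     (\<forall>(dA, dB, \<sigma>) \<in> locc_branches P 4 4 \<rho>. mat_trace \<sigma> \<noteq> 0 \<longrightarrow>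
        (\<exists>m n. dA = 2 * m \<and> dB = 2 * n \<and>
               (1 / mat_trace \<sigma>) \<cdot>\<^sub>m reduced_AB m n \<sigma> = density bell_state))"

definition bank_measures_restorable :: "complex mat \<Rightarrow> complex mat \<Rightarrow> bool" where
  "bank_measures_restorable \<psi> w \<longleftrightarrow>
     (\<exists>Ms P. is_measurement 2 Ms \<and>
        (\<forall>k<length Ms. locc_valid (P k) 4 4 \<and>
           restores_bell (P k) (bank_outcome_state (Ms ! k) (density (global_state \<psi> w)))))"

end

theory Submission
  imports Defs "HOL-Analysis.Convex"
begin

text \<open>A pure state of Alice and Bob is identified with its matrix \<open>\<Phi>\<close> of coefficients; local operators
  act on it by multiplication from the left and from the right.

  Necessity: call \<open>\<Phi>\<close> half-bounded if its largest squared singular value is at most half of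
  \<open>\<parallel>\<Phi>\<parallel>\<^sup>2\<close>.  Every component of a state that reduces to a Bell pair is half-bounded, and if all branches of a
  local measurement of \<open>\<Phi>\<close> are, then so is \<open>\<Phi>\<close>, because \<open>\<Sum>\<^sub>K \<parallel>K \<Phi> x\<parallel>\<^sup>2 = \<parallel>\<Phi> x\<parallel>\<^sup>2\<close>.  Hence every
  component left by the Bank is half-bounded.  For the component with amplitudes \<open>a\<close>, \<open>b\<close> of
  \<open>\<langle>0|\<close>, \<open>\<langle>1|\<close> and probability \<open>N\<close> this reads \<open>2 \<bar>a\<bar>\<^sup>2 \<beta> \<gamma> \<ge> N sqrt (1 - tan \<theta> ^ 4)\<close>, and
  summing over all components gives the bound.

  Sufficiency: the Bank measures in the basis \<open>|\<plusminus>\<rangle>\<close>.  In both branches the four Schmidt weights are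
  at most \<open>1/2\<close>, so they form a mixture of uniform distributions on pairs.  Alice measures
  accordingly, and both rotate the selected two-dimensional subspace onto their qubit.\<close>

section \<open>Coefficient matrices and mixtures\<close>

lemma dim_mat_adjoint [simp]: "dim_row (mat_adjoint A) = dim_col A" "dim_col (mat_adjoint A) = dim_row A"
  by (simp_all add: mat_adjoint_def)

lemma mat_adjoint_carrier [simp]: "A \<in> carrier_mat m n \<Longrightarrow> mat_adjoint A \<in> carrier_mat n m"
  by (auto intro: carrier_matI)

lemma mat_adjoint_index [simp]:
  fixes A :: "complex mat"
  assumes "i < dim_col A" "j < dim_row A"
  shows "mat_adjoint A $$ (i, j) = cnj (A $$ (j, i))"
  using assms by (simp add: mat_adjoint_def mat_of_rows_def)

lemma index_mult_mat_sum:
  fixes A B :: "complex mat"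
  assumes "A \<in> carrier_mat m k" "B \<in> carrier_mat k n" "i < m" "j < n"
  shows "(A * B) $$ (i, j) = (\<Sum>l<k. A $$ (i, l) * B $$ (l, j))"
  using assms by (auto simp: scalar_prod_def atLeast0LessThan intro!: sum.cong)

lemma mat_adjoint_mult:
  fixes A B :: "complex mat"
  assumes "A \<in> carrier_mat m k" "B \<in> carrier_mat k n"
  shows "mat_adjoint (A * B) = mat_adjoint B * mat_adjoint A"
  using assms by (intro eq_matI) (auto simp: scalar_prod_def mult.commute)

lemma density_carrier [simp]: "v \<in> carrier_mat d 1 \<Longrightarrow> density v \<in> carrier_mat d d"
  by (simp add: density_def mult_carrier_mat[of _ d 1])

lemma density_index:
  assumes "v \<in> carrier_mat d 1" "i < d" "j < d"
  shows "density v $$ (i, j) = v $$ (i, 0) * cnj (v $$ (j, 0))"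
  using assms by (auto simp: density_def scalar_prod_def)

lemma density_conj:
  assumes K: "K \<in> carrier_mat d' d" and v: "v \<in> carrier_mat d 1"
  shows "K * density v * mat_adjoint K = density (K * v)"
proof -
  have vd: "mat_adjoint v \<in> carrier_mat 1 d" and Kd: "mat_adjoint K \<in> carrier_mat d d'"
    using K v by simp_all
  have "K * density v * mat_adjoint K = (K * v) * mat_adjoint v * mat_adjoint K"
    unfolding density_def using assoc_mult_mat[OF K v vd] by simp
  also have "\<dots> = (K * v) * (mat_adjoint v * mat_adjoint K)"
    by (rule assoc_mult_mat[OF mult_carrier_mat[OF K v] vd Kd])
  also have "\<dots> = density (K * v)"
    by (simp add: density_def mat_adjoint_mult[OF K v])
  finally show ?thesis .
qed

lemma mat_sum_Nil [simp]: "mat_sum d [] = 0\<^sub>m d d"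
  and mat_sum_Cons [simp]: "mat_sum d (A # As) = A + mat_sum d As"
  by (simp_all add: mat_sum_def)

lemma mat_sum_carrier [simp]: "set As \<subseteq> carrier_mat d d \<Longrightarrow> mat_sum d As \<in> carrier_mat d d"
  by (induction As) auto

lemma mat_sum_index:
  assumes "set As \<subseteq> carrier_mat d d" "i < d" "j < d"
  shows "mat_sum d As $$ (i, j) = (\<Sum>A\<leftarrow>As. A $$ (i, j))"
  using assms(1)
proof (induction As)
  case (Cons A As)
  have "mat_sum d As \<in> carrier_mat d d"
    by (rule mat_sum_carrier) (use Cons in auto)
  then have "dim_row (mat_sum d As) = d" "dim_col (mat_sum d As) = d" by auto
  with Cons assms(2,3) show ?case by auto
qed (use assms in simp)

lemma mat_sum_append:
  assumes "set As \<subseteq> carrier_mat d d" "set Bs \<subseteq> carrier_mat d d"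
  shows "mat_sum d (As @ Bs) = mat_sum d As + mat_sum d Bs"
  using assms(1)
proof (induction As)
  case Nil
  have "mat_sum d Bs \<in> carrier_mat d d" using assms by simp
  then show ?case by simp
next
  case (Cons A As)
  then have "A \<in> carrier_mat d d" "mat_sum d As \<in> carrier_mat d d" "mat_sum d Bs \<in> carrier_mat d d"
    using assms by auto
  with Cons show ?case by (simp add: assoc_add_mat[of _ d d])
qed

lemma mat_sum_conj:
  assumes K: "K \<in> carrier_mat d' d" and "set As \<subseteq> carrier_mat d d"
  shows "K * mat_sum d As * mat_adjoint K = mat_sum d' (map (\<lambda>A. K * A * mat_adjoint K) As)"
  using assms(2)
proof (induction As)
  case Nil
  have "K * 0\<^sub>m d d = 0\<^sub>m d' d" using K by simp
  moreover have "0\<^sub>m d' d * mat_adjoint K = 0\<^sub>m d' d'" using K by simp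
  ultimately show ?case by simp
next
  case (Cons A As)
  have A: "A \<in> carrier_mat d d" and S: "mat_sum d As \<in> carrier_mat d d" using Cons by auto
  have "K * (A + mat_sum d As) * mat_adjoint K = (K * A + K * mat_sum d As) * mat_adjoint K"
    by (simp add: mult_add_distrib_mat[OF K A S])
  also have "\<dots> = K * A * mat_adjoint K + K * mat_sum d As * mat_adjoint K"
    by (rule add_mult_distrib_mat[of _ d' d _ _ d']) (use K A S in \<open>auto intro: mult_carrier_mat\<close>)
  finally show ?case using Cons by simp
qed

section \<open>Vectorised bipartite states and local Kraus operators\<close>

lemma sum_div_mod:
  fixes f :: "nat \<Rightarrow> nat \<Rightarrow> 'a::comm_monoid_add"
  shows "(\<Sum>k<m * n. f (k div n) (k mod n)) = (\<Sum>i<m. \<Sum>j<n. f i j)"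
proof (cases "n = 0")
  case False
  have "(\<Sum>k<m * n. f (k div n) (k mod n)) = (\<Sum>i<m. \<Sum>k\<in>{i * n..<i * n + n}. f (k div n) (k mod n))"
    by (rule sum.nat_group[symmetric])
  also have "\<dots> = (\<Sum>i<m. \<Sum>j<n. f i j)"
  proof (rule sum.cong[OF refl])
    fix i
    have "(\<Sum>k\<in>{i * n..<i * n + n}. f (k div n) (k mod n))
      = (\<Sum>k\<in>{0..<n}. f ((k + i * n) div n) ((k + i * n) mod n))"
      using sum.shift_bounds_nat_ivl[of "\<lambda>k. f (k div n) (k mod n)" 0 "i * n" n]
      by (simp add: add.commute)
    also have "\<dots> = (\<Sum>j<n. f i j)"
      by (rule sum.cong) auto
    finally show "(\<Sum>k\<in>{i * n..<i * n + n}. f (k div n) (k mod n)) = (\<Sum>j<n. f i j)" .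
  qed
  finally show ?thesis .
qed simp

text \<open>Row-major vectorisation, matching the index convention of \<open>kron\<close>: rows of
  \<open>\<Phi>\<close> belong to the left factor (mostly Alice), columns to the right one (mostly
  Bob).\<close>

definition coeff_ket :: "complex mat \<Rightarrow> complex mat" where
  "coeff_ket \<Phi> = mat (dim_row \<Phi> * dim_col \<Phi>) 1 (\<lambda>(i, _). \<Phi> $$ (i div dim_col \<Phi>, i mod dim_col \<Phi>))"

text \<open>A mixed state is kept as a list of unnormalised pure components, so that Kraus maps act
  on the list component by component. Zero and repeated components are allowed.\<close>

definition mixture :: "nat \<Rightarrow> nat \<Rightarrow> complex mat list \<Rightarrow> complex mat" where
  "mixture m n \<Phi>s = mat_sum (m * n) (map (\<lambda>\<Phi>. density (coeff_ket \<Phi>)) \<Phi>s)"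

lemma coeff_ket_carrier: "\<Phi> \<in> carrier_mat m n \<Longrightarrow> coeff_ket \<Phi> \<in> carrier_mat (m * n) 1"
  by (auto simp: coeff_ket_def)

lemma coeff_ket_index:
  "\<Phi> \<in> carrier_mat m n \<Longrightarrow> i < m * n \<Longrightarrow> coeff_ket \<Phi> $$ (i, 0) = \<Phi> $$ (i div n, i mod n)"
  by (auto simp: coeff_ket_def)

lemma div_less_of_less_mult: "(i::nat) < m * n \<Longrightarrow> i div n < m"
  by (simp add: less_mult_imp_div_less)

lemma mod_less_of_less_mult: "(i::nat) < m * n \<Longrightarrow> i mod n < n"
  by (metis mod_less_divisor mult_0_right neq0_conv not_less0)

lemma kron_carrier: "A \<in> carrier_mat m n \<Longrightarrow> B \<in> carrier_mat p q \<Longrightarrow> A \<otimes>\<^sub>m B \<in> carrier_mat (m * p) (n * q)"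
  by (auto simp: kron_def)

lemma kron_index:
  "A \<in> carrier_mat m n \<Longrightarrow> B \<in> carrier_mat p q \<Longrightarrow> i < m * p \<Longrightarrow> j < n * q \<Longrightarrow>
   (A \<otimes>\<^sub>m B) $$ (i, j) = A $$ (i div p, j div q) * B $$ (i mod p, j mod q)"
  by (auto simp: kron_def)

text \<open>The identity factor is a Kronecker delta in the right index, which leaves the single sum
  of a matrix product.\<close>

lemma kron_one_coeff_ket:
  assumes K: "K \<in> carrier_mat m' m" and \<Phi>: "\<Phi> \<in> carrier_mat m n"
  shows "(K \<otimes>\<^sub>m 1\<^sub>m n) * coeff_ket \<Phi> = coeff_ket (K * \<Phi>)"
proof (rule eq_matI)
  have K\<Phi>: "K * \<Phi> \<in> carrier_mat m' n" using K \<Phi> by simp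
  show "dim_row ((K \<otimes>\<^sub>m 1\<^sub>m n) * coeff_ket \<Phi>) = dim_row (coeff_ket (K * \<Phi>))"
    "dim_col ((K \<otimes>\<^sub>m 1\<^sub>m n) * coeff_ket \<Phi>) = dim_col (coeff_ket (K * \<Phi>))"
    using kron_carrier[OF K one_carrier_mat[of n]] coeff_ket_carrier[OF \<Phi>] coeff_ket_carrier[OF K\<Phi>] by auto
  fix i j assume "i < dim_row (coeff_ket (K * \<Phi>))" "j < dim_col (coeff_ket (K * \<Phi>))"
  then have i: "i < m' * n" and j: "j = 0" using coeff_ket_carrier[OF K\<Phi>] by auto
  note im = div_less_of_less_mult[OF i] mod_less_of_less_mult[OF i]
  have "((K \<otimes>\<^sub>m 1\<^sub>m n) * coeff_ket \<Phi>) $$ (i, 0)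
    = (\<Sum>k<m * n. (K \<otimes>\<^sub>m 1\<^sub>m n) $$ (i, k) * coeff_ket \<Phi> $$ (k, 0))"
    by (rule index_mult_mat_sum[OF kron_carrier[OF K one_carrier_mat[of n]] coeff_ket_carrier[OF \<Phi>]]) (use i in auto)
  also have "\<dots> = (\<Sum>k<m * n. (\<lambda>r s. K $$ (i div n, r) * (if i mod n = s then 1 else 0) * \<Phi> $$ (r, s)) (k div n) (k mod n))"
    by (rule sum.cong) (use K \<Phi> i im mod_less_of_less_mult in
        \<open>auto simp: kron_index[OF K one_carrier_mat[of n]] coeff_ket_index[OF \<Phi>]\<close>)
  also have "\<dots> = (\<Sum>r<m. \<Sum>s<n. K $$ (i div n, r) * (if i mod n = s then 1 else 0) * \<Phi> $$ (r, s))"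
    by (rule sum_div_mod)
  also have "\<dots> = (\<Sum>r<m. K $$ (i div n, r) * \<Phi> $$ (r, i mod n))"
    by (rule sum.cong) (use im in \<open>auto simp: if_distrib if_distribR sum.delta cong: if_cong\<close>)
  also have "\<dots> = (K * \<Phi>) $$ (i div n, i mod n)"
    by (rule index_mult_mat_sum[OF K \<Phi> im, symmetric])
  finally show "((K \<otimes>\<^sub>m 1\<^sub>m n) * coeff_ket \<Phi>) $$ (i, j) = coeff_ket (K * \<Phi>) $$ (i, j)"
    using coeff_ket_index[OF K\<Phi> i] j by simp
qed

text \<open>Now the delta sits in the left index. The transpose, and not the adjoint, appears
  because vectorisation involves no conjugation.\<close>

lemma one_kron_coeff_ket:
  assumes K: "K \<in> carrier_mat n' n" and \<Phi>: "\<Phi> \<in> carrier_mat m n"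
  shows "(1\<^sub>m m \<otimes>\<^sub>m K) * coeff_ket \<Phi> = coeff_ket (\<Phi> * transpose_mat K)"
proof (rule eq_matI)
  have Kt: "transpose_mat K \<in> carrier_mat n n'" using K by simp
  have \<Phi>K: "\<Phi> * transpose_mat K \<in> carrier_mat m n'" using Kt \<Phi> by simp
  show "dim_row ((1\<^sub>m m \<otimes>\<^sub>m K) * coeff_ket \<Phi>) = dim_row (coeff_ket (\<Phi> * transpose_mat K))"
    "dim_col ((1\<^sub>m m \<otimes>\<^sub>m K) * coeff_ket \<Phi>) = dim_col (coeff_ket (\<Phi> * transpose_mat K))"
    using kron_carrier[OF one_carrier_mat[of m] K] coeff_ket_carrier[OF \<Phi>] coeff_ket_carrier[OF \<Phi>K] by auto
  fix i j assume "i < dim_row (coeff_ket (\<Phi> * transpose_mat K))" "j < dim_col (coeff_ket (\<Phi> * transpose_mat K))"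
  then have i: "i < m * n'" and j: "j = 0" using coeff_ket_carrier[OF \<Phi>K] by auto
  note im = div_less_of_less_mult[OF i] mod_less_of_less_mult[OF i]
  have "((1\<^sub>m m \<otimes>\<^sub>m K) * coeff_ket \<Phi>) $$ (i, 0)
    = (\<Sum>k<m * n. (1\<^sub>m m \<otimes>\<^sub>m K) $$ (i, k) * coeff_ket \<Phi> $$ (k, 0))"
    by (rule index_mult_mat_sum[OF kron_carrier[OF one_carrier_mat[of m] K] coeff_ket_carrier[OF \<Phi>]]) (use i in auto)
  also have "\<dots> = (\<Sum>k<m * n. (\<lambda>r s. (if i div n' = r then 1 else 0) * K $$ (i mod n', s) * \<Phi> $$ (r, s)) (k div n) (k mod n))"
    by (rule sum.cong) (use K \<Phi> i im div_less_of_less_mult in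
        \<open>auto simp: kron_index[OF one_carrier_mat[of m] K] coeff_ket_index[OF \<Phi>]\<close>)
  also have "\<dots> = (\<Sum>r<m. \<Sum>s<n. (if i div n' = r then 1 else 0) * K $$ (i mod n', s) * \<Phi> $$ (r, s))"
    by (rule sum_div_mod)
  also have "\<dots> = (\<Sum>r<m. if i div n' = r then (\<Sum>s<n. \<Phi> $$ (r, s) * K $$ (i mod n', s)) else 0)"
    by (rule sum.cong) (auto simp: mult.commute)
  also have "\<dots> = (\<Sum>s<n. \<Phi> $$ (i div n', s) * transpose_mat K $$ (s, i mod n'))"
    using im K by (simp add: sum.delta)
  also have "\<dots> = (\<Phi> * transpose_mat K) $$ (i div n', i mod n')"
    by (rule index_mult_mat_sum[OF \<Phi> Kt im, symmetric])
  finally show "((1\<^sub>m m \<otimes>\<^sub>m K) * coeff_ket \<Phi>) $$ (i, j) = coeff_ket (\<Phi> * transpose_mat K) $$ (i, j)"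
    using coeff_ket_index[OF \<Phi>K i] j by simp
qed

lemma mixture_carrier: "set \<Phi>s \<subseteq> carrier_mat m n \<Longrightarrow> mixture m n \<Phi>s \<in> carrier_mat (m * n) (m * n)"
  unfolding mixture_def by (rule mat_sum_carrier) (auto intro!: density_carrier coeff_ket_carrier)

lemma mixture_index:
  assumes "set \<Phi>s \<subseteq> carrier_mat m n" "i < m * n" "j < m * n"
  shows "mixture m n \<Phi>s $$ (i, j)
    = (\<Sum>\<Phi>\<leftarrow>\<Phi>s. \<Phi> $$ (i div n, i mod n) * cnj (\<Phi> $$ (j div n, j mod n)))"
proof -
  have "mixture m n \<Phi>s $$ (i, j) = (\<Sum>A\<leftarrow>map (\<lambda>\<Phi>. density (coeff_ket \<Phi>)) \<Phi>s. A $$ (i, j))"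
    unfolding mixture_def
    by (rule mat_sum_index) (use assms in \<open>auto intro!: density_carrier coeff_ket_carrier\<close>)
  also have "\<dots> = (\<Sum>\<Phi>\<leftarrow>\<Phi>s. \<Phi> $$ (i div n, i mod n) * cnj (\<Phi> $$ (j div n, j mod n)))"
    unfolding map_map o_def
    by (intro arg_cong[where f = sum_list] map_cong refl, subst density_index[OF coeff_ket_carrier])
      (use assms in \<open>auto simp: coeff_ket_index subset_eq\<close>)
  finally show ?thesis .
qed

text \<open>A common form for both parties: \<open>T\<close> embeds a local operator into the joint
  space and \<open>f\<close> is its effect on coefficient matrices. By \<open>density_conj\<close>,
  each pair of a Kraus operator and a component yields one new component.\<close>

lemma kraus_map_mixture:
  assumes carr: "set \<Phi>s \<subseteq> carrier_mat m n"
    and T: "\<And>K. K \<in> set Ks \<Longrightarrow> T K \<in> carrier_mat (m' * n') (m * n)"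
    and act: "\<And>K \<Phi>. K \<in> set Ks \<Longrightarrow> \<Phi> \<in> set \<Phi>s \<Longrightarrow>
      f K \<Phi> \<in> carrier_mat m' n' \<and> T K * coeff_ket \<Phi> = coeff_ket (f K \<Phi>)"
  shows "kraus_map (m' * n') (map T Ks) (mixture m n \<Phi>s)
    = mixture m' n' (concat (map (\<lambda>K. map (f K) \<Phi>s) Ks))"
  using T act
proof (induction Ks)
  case Nil
  then show ?case by (simp add: kraus_map_def mixture_def)
next
  case (Cons K Ks)
  have K: "T K \<in> carrier_mat (m' * n') (m * n)" using Cons by simp
  have "T K * mixture m n \<Phi>s * mat_adjoint (T K)
    = mat_sum (m' * n') (map (\<lambda>A. T K * A * mat_adjoint (T K)) (map (\<lambda>\<Phi>. density (coeff_ket \<Phi>)) \<Phi>s))"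
    unfolding mixture_def by (rule mat_sum_conj[OF K]) (use carr in \<open>auto intro!: density_carrier coeff_ket_carrier\<close>)
  also have "\<dots> = mixture m' n' (map (f K) \<Phi>s)"
    unfolding mixture_def map_map o_def
  proof (intro arg_cong[where f = "mat_sum (m' * n')"] map_cong refl)
    fix \<Phi> assume \<Phi>: "\<Phi> \<in> set \<Phi>s"
    then have "coeff_ket \<Phi> \<in> carrier_mat (m * n) 1" using carr coeff_ket_carrier by blast
    from density_conj[OF K this] Cons.prems(2) \<Phi>
    show "T K * density (coeff_ket \<Phi>) * mat_adjoint (T K) = density (coeff_ket (f K \<Phi>))" by simp
  qed
  finally have 1: "T K * mixture m n \<Phi>s * mat_adjoint (T K) = mixture m' n' (map (f K) \<Phi>s)" .
  have 2: "kraus_map (m' * n') (map T (K # Ks)) (mixture m n \<Phi>s)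
    = T K * mixture m n \<Phi>s * mat_adjoint (T K) + kraus_map (m' * n') (map T Ks) (mixture m n \<Phi>s)"
    by (simp add: kraus_map_def)
  have "mixture m' n' (map (f K) \<Phi>s) + mixture m' n' (concat (map (\<lambda>K. map (f K) \<Phi>s) Ks))
    = mixture m' n' (concat (map (\<lambda>K. map (f K) \<Phi>s) (K # Ks)))"
    unfolding mixture_def list.map concat.simps map_append
    by (rule mat_sum_append[symmetric]) (use Cons.prems in \<open>auto intro!: density_carrier coeff_ket_carrier\<close>)
  with 1 2 Cons show ?case by simp
qed

lemma kraus_map_Alice:
  assumes "set \<Phi>s \<subseteq> carrier_mat m n" "set Ks \<subseteq> carrier_mat m' m"
  shows "kraus_map (m' * n) (map (\<lambda>K. K \<otimes>\<^sub>m 1\<^sub>m n) Ks) (mixture m n \<Phi>s)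
    = mixture m' n (concat (map (\<lambda>K. map (\<lambda>\<Phi>. K * \<Phi>) \<Phi>s) Ks))"
  by (rule kraus_map_mixture)
    (use assms in \<open>auto intro!: kron_carrier kron_one_coeff_ket mult_carrier_mat simp: subset_eq\<close>)

lemma kraus_map_Bob:
  assumes "set \<Phi>s \<subseteq> carrier_mat m n" "set Ks \<subseteq> carrier_mat n' n"
  shows "kraus_map (m * n') (map (\<lambda>K. 1\<^sub>m m \<otimes>\<^sub>m K) Ks) (mixture m n \<Phi>s)
    = mixture m n' (concat (map (\<lambda>K. map (\<lambda>\<Phi>. \<Phi> * transpose_mat K) \<Phi>s) Ks))"
  by (rule kraus_map_mixture)
    (use assms in \<open>auto intro!: kron_carrier one_kron_coeff_ket mult_carrier_mat simp: subset_eq\<close>)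

section \<open>Half-bounded coefficient matrices\<close>

lemma Cauchy_Schwarz_complex:
  fixes f g :: "'a \<Rightarrow> complex"
  shows "(cmod (\<Sum>i\<in>I. f i * g i))\<^sup>2 \<le> (\<Sum>i\<in>I. (cmod (f i))\<^sup>2) * (\<Sum>i\<in>I. (cmod (g i))\<^sup>2)"
proof -
  have "cmod (\<Sum>i\<in>I. f i * g i) \<le> (\<Sum>i\<in>I. cmod (f i) * cmod (g i))"
    by (rule order_trans[OF norm_sum]) (simp add: norm_mult)
  then have "(cmod (\<Sum>i\<in>I. f i * g i))\<^sup>2 \<le> (\<Sum>i\<in>I. cmod (f i) * cmod (g i))\<^sup>2"
    by (rule power_mono) simp
  also have "\<dots> \<le> (\<Sum>i\<in>I. (cmod (f i))\<^sup>2) * (\<Sum>i\<in>I. (cmod (g i))\<^sup>2)"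
    by (rule Cauchy_Schwarz_ineq_sum)
  finally show ?thesis .
qed

lemma sum_list_sum_swap:
  fixes f :: "'a \<Rightarrow> 'b \<Rightarrow> 'c::comm_monoid_add"
  shows "(\<Sum>x\<leftarrow>xs. \<Sum>j\<in>J. f x j) = (\<Sum>j\<in>J. \<Sum>x\<leftarrow>xs. f x j)"
  by (induction xs) (simp_all add: sum.distrib)

lemma of_real_sum_list: "of_real (\<Sum>x\<leftarrow>xs. f x) = (\<Sum>x\<leftarrow>xs. of_real (f x))"
  by (induction xs) simp_all

text \<open>The squared norm of \<open>K\<close> applied to \<open>z\<close>, written as a quadratic
  form in which completeness can be summed over \<open>K\<close>.\<close>

lemma norm_square_quadratic_form:
  assumes K: "K \<in> carrier_mat m d"
  shows "complex_of_real (\<Sum>i<m. (cmod (\<Sum>l<d. K $$ (i, l) * z l))\<^sup>2)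
    = (\<Sum>l<d. \<Sum>k<d. (mat_adjoint K * K) $$ (l, k) * (cnj (z l) * z k))"
proof -
  have "complex_of_real (\<Sum>i<m. (cmod (\<Sum>l<d. K $$ (i, l) * z l))\<^sup>2)
    = (\<Sum>i<m. cnj (\<Sum>l<d. K $$ (i, l) * z l) * (\<Sum>k<d. K $$ (i, k) * z k))"
    unfolding of_real_sum by (intro sum.cong refl) (simp only: complex_norm_square mult.commute)
  also have "\<dots> = (\<Sum>i<m. \<Sum>l<d. \<Sum>k<d. cnj (K $$ (i, l)) * K $$ (i, k) * (cnj (z l) * z k))"
    unfolding cnj_sum sum_product by (intro sum.cong refl) (simp add: mult_ac)
  also have "\<dots> = (\<Sum>l<d. \<Sum>k<d. \<Sum>i<m. cnj (K $$ (i, l)) * K $$ (i, k) * (cnj (z l) * z k))"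
    by (subst sum.swap) (intro sum.cong refl sum.swap)
  also have "\<dots> = (\<Sum>l<d. \<Sum>k<d. (mat_adjoint K * K) $$ (l, k) * (cnj (z l) * z k))"
    by (intro sum.cong refl, subst index_mult_mat_sum[OF mat_adjoint_carrier[OF K] K])
      (use K in \<open>auto simp: sum_distrib_right\<close>)
  finally show ?thesis .
qed

text \<open>Summing the quadratic forms turns their matrices into the identity. The operators may
  have different numbers of rows, since outcomes of an instrument may have different output
  dimensions.\<close>

lemma complete_Kraus_norm:
  assumes Ks: "\<And>K. K \<in> set Ks \<Longrightarrow> K \<in> carrier_mat (dim_row K) d"
    and complete: "mat_sum d (map (\<lambda>K. mat_adjoint K * K) Ks) = 1\<^sub>m d"
  shows "(\<Sum>K\<leftarrow>Ks. \<Sum>i<dim_row K. (cmod (\<Sum>l<d. K $$ (i, l) * z l))\<^sup>2) = (\<Sum>l<d. (cmod (z l))\<^sup>2)"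
proof -
  have "complex_of_real (\<Sum>K\<leftarrow>Ks. \<Sum>i<dim_row K. (cmod (\<Sum>l<d. K $$ (i, l) * z l))\<^sup>2)
    = (\<Sum>K\<leftarrow>Ks. \<Sum>l<d. \<Sum>k<d. (mat_adjoint K * K) $$ (l, k) * (cnj (z l) * z k))"
    unfolding of_real_sum_list
    by (intro arg_cong[where f = sum_list] map_cong refl norm_square_quadratic_form Ks)
  also have "\<dots> = (\<Sum>l<d. \<Sum>k<d. (\<Sum>K\<leftarrow>Ks. (mat_adjoint K * K) $$ (l, k)) * (cnj (z l) * z k))"
    by (simp add: sum_list_sum_swap sum_list_mult_const)
  also have "\<dots> = (\<Sum>l<d. \<Sum>k<d. (1\<^sub>m d $$ (l, k)) * (cnj (z l) * z k))"
  proof (intro sum.cong refl)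
    fix l k assume "l \<in> {..<d}" "k \<in> {..<d}"
    moreover have "set (map (\<lambda>K. mat_adjoint K * K) Ks) \<subseteq> carrier_mat d d"
      unfolding set_map using mult_carrier_mat[OF mat_adjoint_carrier[OF Ks] Ks] by blast
    ultimately show "(\<Sum>K\<leftarrow>Ks. (mat_adjoint K * K) $$ (l, k)) * (cnj (z l) * z k)
      = 1\<^sub>m d $$ (l, k) * (cnj (z l) * z k)"
      using mat_sum_index[of "map (\<lambda>K. mat_adjoint K * K) Ks" d l k] complete by (simp add: o_def)
  qed
  also have "\<dots> = (\<Sum>l<d. z l * cnj (z l))"
    by (simp add: mult.commute if_distrib if_distribR cong: if_cong)
  also have "\<dots> = complex_of_real (\<Sum>l<d. (cmod (z l))\<^sup>2)"
    by (simp add: complex_norm_square del: of_real_power)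
  finally show ?thesis using of_real_eq_iff by blast
qed

text \<open>The squared Frobenius norm; by \<open>mixture_trace\<close> it is the contribution of a
  component to the probability of its branch.\<close>

definition frob2 :: "complex mat \<Rightarrow> real" where
  "frob2 \<Phi> = (\<Sum>i<dim_row \<Phi>. \<Sum>j<dim_col \<Phi>. (cmod (\<Phi> $$ (i, j)))\<^sup>2)"

text \<open>The bound on the largest singular value as a bound on bilinear forms, which makes it
  visibly symmetric in Alice and Bob and avoids singular value decompositions.\<close>

definition half_bounded :: "complex mat \<Rightarrow> bool" where
  "half_bounded \<Phi> \<longleftrightarrow> (\<forall>x y.
     (cmod (\<Sum>i<dim_row \<Phi>. \<Sum>j<dim_col \<Phi>. y i * \<Phi> $$ (i, j) * x j))\<^sup>2
     \<le> frob2 \<Phi> / 2 * (\<Sum>j<dim_col \<Phi>. (cmod (x j))\<^sup>2) * (\<Sum>i<dim_row \<Phi>. (cmod (y i))\<^sup>2))"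

lemma frob2_nonneg: "0 \<le> frob2 \<Phi>"
  by (simp add: frob2_def sum_nonneg)

lemma frob2_transpose: "frob2 (transpose_mat \<Phi>) = frob2 \<Phi>"
  unfolding frob2_def by (subst sum.swap) simp

lemma half_bounded_transpose:
  assumes "half_bounded \<Phi>"
  shows "half_bounded (transpose_mat \<Phi>)"
  unfolding half_bounded_def frob2_transpose
proof (intro allI)
  fix x y :: "nat \<Rightarrow> complex"
  have "(\<Sum>i<dim_row (transpose_mat \<Phi>). \<Sum>j<dim_col (transpose_mat \<Phi>). y i * transpose_mat \<Phi> $$ (i, j) * x j)
    = (\<Sum>i<dim_row \<Phi>. \<Sum>j<dim_col \<Phi>. x i * \<Phi> $$ (i, j) * y j)"
    by (subst sum.swap) (simp add: mult_ac)
  then show "(cmod (\<Sum>i<dim_row (transpose_mat \<Phi>). \<Sum>j<dim_col (transpose_mat \<Phi>).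
        y i * transpose_mat \<Phi> $$ (i, j) * x j))\<^sup>2
    \<le> frob2 \<Phi> / 2 * (\<Sum>j<dim_col (transpose_mat \<Phi>). (cmod (x j))\<^sup>2) *
      (\<Sum>i<dim_row (transpose_mat \<Phi>). (cmod (y i))\<^sup>2)"
    using assms[unfolded half_bounded_def, rule_format, of x y] by (simp add: mult_ac)
qed

text \<open>The operator norm form of the bound. Taking \<open>y\<close> as the conjugate of the
  image of \<open>x\<close> turns the bilinear form into the squared norm of that image, one factor
  of which then cancels.\<close>

lemma half_bounded_image:
  assumes "half_bounded \<Phi>"
  shows "(\<Sum>i<dim_row \<Phi>. (cmod (\<Sum>j<dim_col \<Phi>. \<Phi> $$ (i, j) * x j))\<^sup>2)
    \<le> frob2 \<Phi> / 2 * (\<Sum>j<dim_col \<Phi>. (cmod (x j))\<^sup>2)" (is "?S \<le> ?R")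
proof -
  define y where "y i = cnj (\<Sum>j<dim_col \<Phi>. \<Phi> $$ (i, j) * x j)" for i
  have "(\<Sum>i<dim_row \<Phi>. \<Sum>j<dim_col \<Phi>. y i * \<Phi> $$ (i, j) * x j)
    = (\<Sum>i<dim_row \<Phi>. y i * (\<Sum>j<dim_col \<Phi>. \<Phi> $$ (i, j) * x j))"
    by (simp add: sum_distrib_left mult.assoc)
  also have "\<dots> = complex_of_real ?S"
    unfolding y_def of_real_sum by (intro sum.cong refl) (simp only: complex_norm_square mult.commute)
  finally have "(cmod (complex_of_real ?S))\<^sup>2 \<le> ?R * (\<Sum>i<dim_row \<Phi>. (cmod (y i))\<^sup>2)"
    using assms[unfolded half_bounded_def, rule_format, of y x] by simp
  moreover have "(\<Sum>i<dim_row \<Phi>. (cmod (y i))\<^sup>2) = ?S" by (simp only: y_def complex_mod_cnj)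
  ultimately have *: "?S * ?S \<le> ?R * ?S" by (simp only: norm_of_real power2_eq_square abs_mult_self_eq)
  have "0 \<le> ?S" "0 \<le> ?R" by (auto intro!: sum_nonneg mult_nonneg_nonneg simp: frob2_nonneg)
  moreover have "s \<le> r" if "s * s \<le> r * s" "0 \<le> s" "0 \<le> r" for s r :: real
    using that by (cases "s = 0") auto
  ultimately show ?thesis using * by blast
qed

text \<open>Conservation of norm, applied to the columns of \<open>\<Phi>\<close>, shows that the
  values of \<open>frob2\<close> in the branches add up to \<open>frob2 \<Phi>\<close>; applied to
  the image of \<open>x\<close>, it adds up the squared lengths of the branch images. So the bounds
  of the branches sum to the bound for \<open>\<Phi>\<close>.\<close>

lemma half_bounded_Kraus:
  assumes Ks: "\<And>K. K \<in> set Ks \<Longrightarrow> K \<in> carrier_mat (dim_row K) d"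
    and complete: "mat_sum d (map (\<lambda>K. mat_adjoint K * K) Ks) = 1\<^sub>m d"
    and \<Phi>: "\<Phi> \<in> carrier_mat d n"
    and half: "\<And>K. K \<in> set Ks \<Longrightarrow> half_bounded (K * \<Phi>)"
  shows "half_bounded \<Phi>"
  unfolding half_bounded_def
proof (intro allI)
  fix x y :: "nat \<Rightarrow> complex"
  define z where "z i = (\<Sum>j<n. \<Phi> $$ (i, j) * x j)" for i
  let ?X = "\<Sum>j<n. (cmod (x j))\<^sup>2"
  have frob: "(\<Sum>K\<leftarrow>Ks. frob2 (K * \<Phi>)) = frob2 \<Phi>"
  proof -
    have "(\<Sum>K\<leftarrow>Ks. frob2 (K * \<Phi>))
      = (\<Sum>K\<leftarrow>Ks. \<Sum>j<n. \<Sum>i<dim_row K. (cmod (\<Sum>l<d. K $$ (i, l) * \<Phi> $$ (l, j)))\<^sup>2)"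
    proof (intro arg_cong[where f = sum_list] map_cong refl)
      fix K assume "K \<in> set Ks"
      then have K: "K \<in> carrier_mat (dim_row K) d" by (rule Ks)
      have "frob2 (K * \<Phi>) = (\<Sum>i<dim_row K. \<Sum>j<n. (cmod ((K * \<Phi>) $$ (i, j)))\<^sup>2)"
        using \<Phi> by (simp add: frob2_def del: index_mult_mat(1))
      also have "\<dots> = (\<Sum>i<dim_row K. \<Sum>j<n. (cmod (\<Sum>l<d. K $$ (i, l) * \<Phi> $$ (l, j)))\<^sup>2)"
        by (intro sum.cong refl) (simp only: index_mult_mat_sum[OF K \<Phi>] lessThan_iff)
      also have "\<dots> = (\<Sum>j<n. \<Sum>i<dim_row K. (cmod (\<Sum>l<d. K $$ (i, l) * \<Phi> $$ (l, j)))\<^sup>2)"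
        by (rule sum.swap)
      finally show "frob2 (K * \<Phi>)
        = (\<Sum>j<n. \<Sum>i<dim_row K. (cmod (\<Sum>l<d. K $$ (i, l) * \<Phi> $$ (l, j)))\<^sup>2)" .
    qed
    also have "\<dots> = (\<Sum>j<n. \<Sum>l<d. (cmod (\<Phi> $$ (l, j)))\<^sup>2)"
      by (simp only: sum_list_sum_swap[of _ "{..<n}"] complete_Kraus_norm[OF Ks complete])
    also have "\<dots> = frob2 \<Phi>" using \<Phi> by (subst sum.swap) (simp add: frob2_def)
    finally show ?thesis .
  qed
  have "(\<Sum>l<d. (cmod (z l))\<^sup>2) = (\<Sum>K\<leftarrow>Ks. \<Sum>i<dim_row K. (cmod (\<Sum>l<d. K $$ (i, l) * z l))\<^sup>2)"
    by (rule complete_Kraus_norm[OF Ks complete, symmetric])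
  also have "\<dots> \<le> (\<Sum>K\<leftarrow>Ks. frob2 (K * \<Phi>) / 2 * ?X)"
  proof (rule sum_list_mono)
    fix K assume KK: "K \<in> set Ks"
    then have K: "K \<in> carrier_mat (dim_row K) d" by (rule Ks)
    have "(\<Sum>l<d. K $$ (i, l) * z l) = (\<Sum>j<n. (K * \<Phi>) $$ (i, j) * x j)" if "i < dim_row K" for i
    proof -
      have "(\<Sum>l<d. K $$ (i, l) * z l) = (\<Sum>l<d. \<Sum>j<n. K $$ (i, l) * \<Phi> $$ (l, j) * x j)"
        by (simp add: z_def sum_distrib_left mult.assoc)
      also have "\<dots> = (\<Sum>j<n. \<Sum>l<d. K $$ (i, l) * \<Phi> $$ (l, j) * x j)" by (rule sum.swap)
      also have "\<dots> = (\<Sum>j<n. (K * \<Phi>) $$ (i, j) * x j)"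
        by (intro sum.cong refl, subst index_mult_mat_sum[OF K \<Phi> that]) (simp_all add: sum_distrib_right)
      finally show ?thesis .
    qed
    then have "(\<Sum>i<dim_row K. (cmod (\<Sum>l<d. K $$ (i, l) * z l))\<^sup>2)
      = (\<Sum>i<dim_row (K * \<Phi>). (cmod (\<Sum>j<dim_col (K * \<Phi>). (K * \<Phi>) $$ (i, j) * x j))\<^sup>2)"
      using \<Phi> by (simp del: index_mult_mat(1))
    also have "\<dots> \<le> frob2 (K * \<Phi>) / 2 * (\<Sum>j<dim_col (K * \<Phi>). (cmod (x j))\<^sup>2)"
      by (rule half_bounded_image[OF half[OF KK]])
    finally show "(\<Sum>i<dim_row K. (cmod (\<Sum>l<d. K $$ (i, l) * z l))\<^sup>2) \<le> frob2 (K * \<Phi>) / 2 * ?X"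
      using \<Phi> by simp
  qed
  also have "\<dots> = (\<Sum>K\<leftarrow>Ks. frob2 (K * \<Phi>)) / 2 * ?X"
    by (simp only: divide_inverse mult.assoc sum_list_mult_const)
  finally have z: "(\<Sum>l<d. (cmod (z l))\<^sup>2) \<le> frob2 \<Phi> / 2 * ?X" unfolding frob .
  \<comment> \<open>Cauchy-Schwarz against \<open>y\<close> converts the bound on the image back
    into one on the bilinear form.\<close>
  have "(\<Sum>i<d. \<Sum>j<n. y i * \<Phi> $$ (i, j) * x j) = (\<Sum>i<d. y i * z i)"
    by (simp add: z_def sum_distrib_left mult.assoc)
  also have "\<dots> = (\<Sum>i<d. z i * y i)"
    by (intro sum.cong refl mult.commute)
  finally have "(cmod (\<Sum>i<d. \<Sum>j<n. y i * \<Phi> $$ (i, j) * x j))\<^sup>2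
    \<le> (\<Sum>i<d. (cmod (z i))\<^sup>2) * (\<Sum>i<d. (cmod (y i))\<^sup>2)"
    by (simp only: Cauchy_Schwarz_complex)
  also have "\<dots> \<le> frob2 \<Phi> / 2 * ?X * (\<Sum>i<d. (cmod (y i))\<^sup>2)"
    by (rule mult_right_mono[OF z]) (simp add: sum_nonneg)
  finally show "(cmod (\<Sum>i<dim_row \<Phi>. \<Sum>j<dim_col \<Phi>. y i * \<Phi> $$ (i, j) * x j))\<^sup>2
     \<le> frob2 \<Phi> / 2 * (\<Sum>j<dim_col \<Phi>. (cmod (x j))\<^sup>2) * (\<Sum>i<dim_row \<Phi>. (cmod (y i))\<^sup>2)"
    using \<Phi> by simp
qed

lemma sum_lessThan_add:
  fixes f :: "nat \<Rightarrow> 'a::comm_monoid_add"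
  shows "(\<Sum>i<m + n. f i) = (\<Sum>i<m. f i) + (\<Sum>r<n. f (m + r))"
  by (induction n) (simp_all add: add.assoc)

lemma sum_lessThan_double:
  fixes f :: "nat \<Rightarrow> 'a::comm_monoid_add"
  shows "(\<Sum>i<2 * m. f i) = (\<Sum>i<m. f i + f (m + i))"
  unfolding mult_2 sum_lessThan_add by (simp add: sum.distrib)

text \<open>The block conditions make \<open>\<Phi>\<close> the Kronecker product of the 2x2
  identity with its upper left block, whose squared norm is half of \<open>frob2 \<Phi>\<close>.
  Cauchy-Schwarz over the entries of the block, and then over its two copies, gives the
  bound.\<close>

lemma half_bounded_bell_tensor:
  assumes \<Phi>: "\<Phi> \<in> carrier_mat (2 * m) (2 * n)"
    and blocks: "\<And>r s. r < m \<Longrightarrow> s < n \<Longrightarrow>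
      \<Phi> $$ (r, n + s) = 0 \<and> \<Phi> $$ (m + r, s) = 0 \<and> \<Phi> $$ (m + r, n + s) = \<Phi> $$ (r, s)"
  shows "half_bounded \<Phi>"
  unfolding half_bounded_def
proof (intro allI)
  fix x y :: "nat \<Rightarrow> complex"
  let ?I = "{..<m} \<times> {..<n}"
  have "frob2 \<Phi> = (\<Sum>i<2 * m. \<Sum>j<2 * n. (cmod (\<Phi> $$ (i, j)))\<^sup>2)"
    using \<Phi> by (simp add: frob2_def)
  also have "\<dots> = (\<Sum>r<m. (\<Sum>s<n. (cmod (\<Phi> $$ (r, s)))\<^sup>2) + (\<Sum>s<n. (cmod (\<Phi> $$ (r, s)))\<^sup>2))"
    unfolding sum_lessThan_double using blocks by (intro sum.cong refl arg_cong2[where f = "(+)"]) auto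
  finally have frob: "frob2 \<Phi> / 2 = (\<Sum>p\<in>?I. (cmod (\<Phi> $$ p))\<^sup>2)"
    unfolding mult_2[symmetric] sum_distrib_left[symmetric]
    by (simp add: sum.cartesian_product case_prod_unfold)
  have "(\<Sum>i<2 * m. \<Sum>j<2 * n. y i * \<Phi> $$ (i, j) * x j)
    = (\<Sum>r<m. \<Sum>s<n. \<Phi> $$ (r, s) * (y r * x s + y (m + r) * x (n + s)))"
    unfolding sum_lessThan_double sum.distrib[symmetric]
    by (intro sum.cong refl) (use blocks in \<open>simp add: distrib_left mult_ac\<close>)
  also have "\<dots> = (\<Sum>p\<in>?I. \<Phi> $$ p * (y (fst p) * x (snd p) + y (m + fst p) * x (n + snd p)))"
    by (simp add: sum.cartesian_product case_prod_unfold)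
  finally have "(cmod (\<Sum>i<2 * m. \<Sum>j<2 * n. y i * \<Phi> $$ (i, j) * x j))\<^sup>2
    \<le> (\<Sum>p\<in>?I. (cmod (\<Phi> $$ p))\<^sup>2) *
      (\<Sum>p\<in>?I. (cmod (y (fst p) * x (snd p) + y (m + fst p) * x (n + snd p)))\<^sup>2)"
    by (simp only: Cauchy_Schwarz_complex)
  also have "\<dots> \<le> (\<Sum>p\<in>?I. (cmod (\<Phi> $$ p))\<^sup>2) *
      (\<Sum>p\<in>?I. ((cmod (y (fst p)))\<^sup>2 + (cmod (y (m + fst p)))\<^sup>2) * ((cmod (x (snd p)))\<^sup>2 + (cmod (x (n + snd p)))\<^sup>2))"
  proof (intro mult_left_mono sum_mono)
    fix p
    \<comment> \<open>Cauchy-Schwarz for two terms, indexed by the truth values.\<close>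
    have "(cmod (\<Sum>b\<in>{True, False}. (if b then y (fst p) else y (m + fst p)) * (if b then x (snd p) else x (n + snd p))))\<^sup>2
      \<le> (\<Sum>b\<in>{True, False}. (cmod (if b then y (fst p) else y (m + fst p)))\<^sup>2) *
        (\<Sum>b\<in>{True, False}. (cmod (if b then x (snd p) else x (n + snd p)))\<^sup>2)"
      by (rule Cauchy_Schwarz_complex)
    then show "(cmod (y (fst p) * x (snd p) + y (m + fst p) * x (n + snd p)))\<^sup>2
      \<le> ((cmod (y (fst p)))\<^sup>2 + (cmod (y (m + fst p)))\<^sup>2) * ((cmod (x (snd p)))\<^sup>2 + (cmod (x (n + snd p)))\<^sup>2)"
      by simp
  qed (simp add: sum_nonneg)
  also have "(\<Sum>p\<in>?I. ((cmod (y (fst p)))\<^sup>2 + (cmod (y (m + fst p)))\<^sup>2) * ((cmod (x (snd p)))\<^sup>2 + (cmod (x (n + snd p)))\<^sup>2))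
    = (\<Sum>j<2 * n. (cmod (x j))\<^sup>2) * (\<Sum>i<2 * m. (cmod (y i))\<^sup>2)"
    unfolding sum_lessThan_double
    by (subst (2) mult.commute) (simp only: sum_product sum.cartesian_product case_prod_unfold)
  finally show "(cmod (\<Sum>i<dim_row \<Phi>. \<Sum>j<dim_col \<Phi>. y i * \<Phi> $$ (i, j) * x j))\<^sup>2
     \<le> frob2 \<Phi> / 2 * (\<Sum>j<dim_col \<Phi>. (cmod (x j))\<^sup>2) * (\<Sum>i<dim_row \<Phi>. (cmod (y i))\<^sup>2)"
    unfolding frob using \<Phi> by (simp add: mult.assoc case_prod_unfold)
qed

section \<open>LOCC protocols preserve the singular value bound\<close>

lemma density_bell_index:
  assumes "i < 4" "j < 4"
  shows "density bell_state $$ (i, j) = (if i \<in> {0, 3} \<and> j \<in> {0, 3} then 1 / 2 else 0)"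
proof -
  have carr: "bell_state \<in> carrier_mat 4 1"
    by (auto simp: bell_state_def kron_def ket_def)
  have ent: "bell_state $$ (k, 0) = (if k \<in> {0, 3} then complex_of_real (1 / sqrt 2) else 0)" if "k < 4" for k
  proof -
    from that consider "k = 0" | "k = 1" | "k = 2" | "k = 3" by linarith
    then show ?thesis by cases (simp_all add: bell_state_def kron_def ket_def)
  qed
  have "complex_of_real (1 / sqrt 2) * cnj (complex_of_real (1 / sqrt 2)) = complex_of_real (1 / sqrt 2 * (1 / sqrt 2))"
    by (simp only: complex_cnj_complex_of_real of_real_mult)
  also have "1 / sqrt 2 * (1 / sqrt 2) = 1 / 2" by simp
  finally show ?thesis
    unfolding density_index[OF carr assms] using assms by (simp add: ent)
qed

lemma density_bell_carrier: "density bell_state \<in> carrier_mat 4 4"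
  by (rule density_carrier) (auto simp: bell_state_def kron_def ket_def)

lemma reduced_AB_mixture:
  assumes carr: "set \<Phi>s \<subseteq> carrier_mat (2 * m) (2 * n)" and "a < 4" "b < 4"
  shows "reduced_AB m n (mixture (2 * m) (2 * n) \<Phi>s) $$ (a, b)
    = (\<Sum>r<m. \<Sum>s<n. \<Sum>\<Phi>\<leftarrow>\<Phi>s. \<Phi> $$ (a div 2 * m + r, a mod 2 * n + s)
        * cnj (\<Phi> $$ (b div 2 * m + r, b mod 2 * n + s)))"
proof -
  have idx: "i * (2 * n) + j < 2 * m * (2 * n) \<and> (i * (2 * n) + j) div (2 * n) = i \<and> (i * (2 * n) + j) mod (2 * n) = j"
    if "i < 2 * m" "j < 2 * n" for i j
  proof -
    have "i * (2 * n) + j < (i + 1) * (2 * n)" using that by simp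
    also have "\<dots> \<le> 2 * m * (2 * n)" using that by (intro mult_le_mono1) simp
    finally show ?thesis using that by simp
  qed
  have r: "c div 2 * m + r < 2 * m" if "c < 4" "r < m" for c r
  proof -
    have "c div 2 \<le> 1" using that by linarith
    then have "c div 2 * m \<le> 1 * m" by (rule mult_le_mono1)
    then show ?thesis using that by linarith
  qed
  have s: "c mod 2 * n + s < 2 * n" if "s < n" for c s
  proof -
    have "c mod 2 \<le> 1" by simp
    then have "c mod 2 * n \<le> 1 * n" by (rule mult_le_mono1)
    then show ?thesis using that by linarith
  qed
  have "reduced_AB m n (mixture (2 * m) (2 * n) \<Phi>s) $$ (a, b)
    = (\<Sum>r<m. \<Sum>s<n. mixture (2 * m) (2 * n) \<Phi>s $$
        ((a div 2 * m + r) * (2 * n) + (a mod 2 * n + s), (b div 2 * m + r) * (2 * n) + (b mod 2 * n + s)))"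
    using assms(2,3) by (simp add: reduced_AB_def)
  also have "\<dots> = (\<Sum>r<m. \<Sum>s<n. \<Sum>\<Phi>\<leftarrow>\<Phi>s. \<Phi> $$ (a div 2 * m + r, a mod 2 * n + s)
        * cnj (\<Phi> $$ (b div 2 * m + r, b mod 2 * n + s)))"
  proof (intro sum.cong refl)
    fix i j assume "i \<in> {..<m}" "j \<in> {..<n}"
    then have i: "i < m" and j: "j < n" by simp_all
    note A = idx[OF r[OF assms(2) i] s[OF j, of a]] and B = idx[OF r[OF assms(3) i] s[OF j, of b]]
    show "mixture (2 * m) (2 * n) \<Phi>s $$
        ((a div 2 * m + i) * (2 * n) + (a mod 2 * n + j), (b div 2 * m + i) * (2 * n) + (b mod 2 * n + j))
      = (\<Sum>\<Phi>\<leftarrow>\<Phi>s. \<Phi> $$ (a div 2 * m + i, a mod 2 * n + j) * cnj (\<Phi> $$ (b div 2 * m + i, b mod 2 * n + j)))"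
      unfolding mixture_index[OF carr A[THEN conjunct1] B[THEN conjunct1]]
      by (simp only: A B)
  qed
  finally show ?thesis .
qed

lemma mixture_trace:
  assumes carr: "set \<Phi>s \<subseteq> carrier_mat m n"
  shows "mat_trace (mixture m n \<Phi>s) = complex_of_real (\<Sum>\<Phi>\<leftarrow>\<Phi>s. frob2 \<Phi>)"
proof -
  have "mat_trace (mixture m n \<Phi>s)
    = (\<Sum>i<m * n. (\<lambda>r s. \<Sum>\<Phi>\<leftarrow>\<Phi>s. \<Phi> $$ (r, s) * cnj (\<Phi> $$ (r, s))) (i div n) (i mod n))"
    unfolding mat_trace_def using mixture_carrier[OF carr]
    by (intro sum.cong) (auto simp: mixture_index[OF carr])
  also have "\<dots> = (\<Sum>r<m. \<Sum>s<n. \<Sum>\<Phi>\<leftarrow>\<Phi>s. \<Phi> $$ (r, s) * cnj (\<Phi> $$ (r, s)))"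
    by (rule sum_div_mod)
  also have "\<dots> = (\<Sum>\<Phi>\<leftarrow>\<Phi>s. \<Sum>r<m. \<Sum>s<n. \<Phi> $$ (r, s) * cnj (\<Phi> $$ (r, s)))"
    by (simp only: sum_list_sum_swap)
  also have "\<dots> = (\<Sum>\<Phi>\<leftarrow>\<Phi>s. complex_of_real (frob2 \<Phi>))"
  proof (intro arg_cong[where f = sum_list] map_cong refl)
    fix \<Phi> assume "\<Phi> \<in> set \<Phi>s"
    then have "\<Phi> \<in> carrier_mat m n" using carr by auto
    then show "(\<Sum>r<m. \<Sum>s<n. \<Phi> $$ (r, s) * cnj (\<Phi> $$ (r, s))) = complex_of_real (frob2 \<Phi>)"
      by (simp add: frob2_def complex_norm_square del: of_real_power)
  qed
  finally show ?thesis by (simp only: of_real_sum_list)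
qed

text \<open>Covers the branches of probability zero, which \<open>restores_bell\<close> leaves
  unconstrained.\<close>

lemma frob2_zero_half_bounded:
  assumes "frob2 \<Phi> = 0"
  shows "half_bounded \<Phi>"
proof -
  have "\<Phi> $$ (i, j) = 0" if "i < dim_row \<Phi>" "j < dim_col \<Phi>" for i j
  proof -
    have "(\<Sum>j<dim_col \<Phi>. (cmod (\<Phi> $$ (i, j)))\<^sup>2) = 0"
      using assms that(1) unfolding frob2_def by (subst (asm) sum_nonneg_eq_0_iff) (auto intro: sum_nonneg)
    then show ?thesis using that(2) by (subst (asm) sum_nonneg_eq_0_iff) auto
  qed
  then have "(\<Sum>i<dim_row \<Phi>. \<Sum>j<dim_col \<Phi>. y i * \<Phi> $$ (i, j) * x j) = 0" for x y
    by simp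
  then show ?thesis unfolding half_bounded_def using assms by simp
qed

text \<open>A vanishing sum of squared moduli vanishes term by term. This turns a zero expectation
  value of the reduced state into a condition on every single component.\<close>

lemma triple_sum_norm_zero:
  fixes h :: "nat \<Rightarrow> nat \<Rightarrow> 'a \<Rightarrow> complex"
  assumes "(\<Sum>r<m. \<Sum>s<n. \<Sum>\<Phi>\<leftarrow>\<Phi>s. h r s \<Phi> * cnj (h r s \<Phi>)) = 0"
    and "r < m" "s < n" "\<Phi> \<in> set \<Phi>s"
  shows "h r s \<Phi> = 0"
proof -
  let ?g = "\<lambda>r s. \<Sum>\<Phi>\<leftarrow>\<Phi>s. (cmod (h r s \<Phi>))\<^sup>2"
  have nonneg: "0 \<le> ?g r s" for r s by (rule sum_list_nonneg) auto
  have "complex_of_real (\<Sum>r<m. \<Sum>s<n. ?g r s) = 0"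
    using assms(1) by (simp only: of_real_sum of_real_sum_list complex_norm_square)
  then have "(\<Sum>r<m. \<Sum>s<n. ?g r s) = 0" by (simp only: of_real_eq_0_iff)
  then have "(\<Sum>s<n. ?g r s) = 0"
    using assms(2) nonneg by (subst (asm) sum_nonneg_eq_0_iff) (auto intro: sum_nonneg)
  then have "?g r s = 0"
    using assms(3) nonneg by (subst (asm) sum_nonneg_eq_0_iff) auto
  then show ?thesis
    using assms(4) by (subst (asm) sum_list_nonneg_eq_0_iff) auto
qed

text \<open>The Bell state is orthogonal to |01>, |10> and |11> - |00>. The expectation values of
  the reduced state in these vectors are sums of squared moduli over all components, so each
  component satisfies the block conditions of \<open>half_bounded_bell_tensor\<close>.\<close>

lemma half_bounded_of_reduced_bell:
  assumes carr: "set \<Phi>s \<subseteq> carrier_mat (2 * m) (2 * n)"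
    and t: "t \<noteq> 0" "t \<cdot>\<^sub>m reduced_AB m n (mixture (2 * m) (2 * n) \<Phi>s) = density bell_state"
    and \<Phi>: "\<Phi> \<in> set \<Phi>s"
  shows "half_bounded \<Phi>"
proof (rule half_bounded_bell_tensor[of _ m n])
  show "\<Phi> \<in> carrier_mat (2 * m) (2 * n)" using carr \<Phi> by auto
  let ?R = "reduced_AB m n (mixture (2 * m) (2 * n) \<Phi>s)"
  have R: "?R $$ (a, b) = (if a \<in> {0, 3} \<and> b \<in> {0, 3} then 1 / (2 * t) else 0)" if "a < 4" "b < 4" for a b
  proof -
    have "t * ?R $$ (a, b) = density bell_state $$ (a, b)"
      unfolding t(2)[symmetric] using that by (simp add: reduced_AB_def)
    then show ?thesis unfolding density_bell_index[OF that] using t(1) by (auto simp: field_simps split: if_splits)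
  qed
  note S = reduced_AB_mixture[OF carr]
  have 1: "(\<Sum>r<m. \<Sum>s<n. \<Sum>\<Phi>\<leftarrow>\<Phi>s. \<Phi> $$ (r, n + s) * cnj (\<Phi> $$ (r, n + s))) = 0"
    using S[of 1 1] R[of 1 1] by simp
  have 2: "(\<Sum>r<m. \<Sum>s<n. \<Sum>\<Phi>\<leftarrow>\<Phi>s. \<Phi> $$ (m + r, s) * cnj (\<Phi> $$ (m + r, s))) = 0"
    using S[of 2 2] R[of 2 2] by simp
  \<comment> \<open>The vector |11> - |00>, unnormalised: the four equal corner entries of the Bell
    density matrix cancel.\<close>
  have 3: "(\<Sum>r<m. \<Sum>s<n. \<Sum>\<Phi>\<leftarrow>\<Phi>s. (\<Phi> $$ (m + r, n + s) - \<Phi> $$ (r, s)) * cnj (\<Phi> $$ (m + r, n + s) - \<Phi> $$ (r, s))) = 0"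
  proof -
    have "(\<Sum>r<m. \<Sum>s<n. \<Sum>\<Phi>\<leftarrow>\<Phi>s. (\<Phi> $$ (m + r, n + s) - \<Phi> $$ (r, s)) * cnj (\<Phi> $$ (m + r, n + s) - \<Phi> $$ (r, s)))
      = ?R $$ (3, 3) - ?R $$ (3, 0) - ?R $$ (0, 3) + ?R $$ (0, 0)"
      using S[of 3 3] S[of 3 0] S[of 0 3] S[of 0 0]
      by (simp add: algebra_simps sum_list_addf sum_list_subtractf sum.distrib sum_subtractf)
    also have "\<dots> = 0" by (simp add: R)
    finally show ?thesis .
  qed
  show "\<Phi> $$ (r, n + s) = 0 \<and> \<Phi> $$ (m + r, s) = 0 \<and> \<Phi> $$ (m + r, n + s) = \<Phi> $$ (r, s)"
    if "r < m" "s < n" for r s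
    using triple_sum_norm_zero[OF 1 that \<Phi>] triple_sum_norm_zero[OF 2 that \<Phi>]
      triple_sum_norm_zero[OF 3 that \<Phi>] by simp
qed

section \<open>Induction over the protocol tree\<close>

lemma is_instrumentD:
  assumes "is_instrument d I"
  shows "K \<in> set (concat (map snd I)) \<Longrightarrow> K \<in> carrier_mat (dim_row K) d"
    and "j < length I \<Longrightarrow> set (snd (I ! j)) \<subseteq> carrier_mat (fst (I ! j)) d"
    and "mat_sum d (map (\<lambda>K. mat_adjoint K * K) (concat (map snd I))) = 1\<^sub>m d"
proof -
  have carr: "\<forall>(d', Ks) \<in> set I. \<forall>K \<in> set Ks. K \<in> carrier_mat d' d"
    and sum: "mat_sum d (concat (map (\<lambda>(d', Ks). map (\<lambda>K. mat_adjoint K * K) Ks) I)) = 1\<^sub>m d"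
    using assms by (auto simp: is_instrument_def)
  show "K \<in> carrier_mat (dim_row K) d" if "K \<in> set (concat (map snd I))"
    using that carr by fastforce
  show "set (snd (I ! j)) \<subseteq> carrier_mat (fst (I ! j)) d" if "j < length I"
    using carr nth_mem[OF that] by (cases "I ! j") auto
  show "mat_sum d (map (\<lambda>K. mat_adjoint K * K) (concat (map snd I))) = 1\<^sub>m d"
    using sum by (simp add: map_concat o_def case_prod_unfold)
qed

text \<open>The induction runs over mixtures of arbitrary local dimensions, because one outcome may
  carry several Kraus operators and change the dimension. The bound still holds for each component
  separately, even if the operators that produced it are not announced.\<close>

lemma half_bounded_of_restoring:
  assumes "locc_valid P dA dB" "set \<Phi>s \<subseteq> carrier_mat dA dB" "\<Phi> \<in> set \<Phi>s"
    and "\<forall>(dA', dB', \<sigma>) \<in> locc_branches P dA dB (mixture dA dB \<Phi>s). mat_trace \<sigma> \<noteq> 0 \<longrightarrow>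
      (\<exists>m n. dA' = 2 * m \<and> dB' = 2 * n \<and> (1 / mat_trace \<sigma>) \<cdot>\<^sub>m reduced_AB m n \<sigma> = density bell_state)"
  shows "half_bounded \<Phi>"
  using assms
proof (induction P arbitrary: dA dB \<Phi>s \<Phi>)
  case Done
  show ?case
  proof (cases "mat_trace (mixture dA dB \<Phi>s) = 0")
    case True
    then have "(\<Sum>\<Phi>\<leftarrow>\<Phi>s. frob2 \<Phi>) = 0" by (simp add: mixture_trace[OF Done(2)])
    then have "frob2 \<Phi> = 0"
      using Done(3) frob2_nonneg by (subst (asm) sum_list_nonneg_eq_0_iff) auto
    then show ?thesis by (rule frob2_zero_half_bounded)
  next
    case False
    with Done(4) obtain m n where d: "dA = 2 * m" "dB = 2 * n"
      and R: "(1 / mat_trace (mixture dA dB \<Phi>s)) \<cdot>\<^sub>m reduced_AB m n (mixture dA dB \<Phi>s) = density bell_state"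
      by auto
    show ?thesis
      by (rule half_bounded_of_reduced_bell[OF Done(2)[unfolded d] _ R[unfolded d] Done(3)])
        (use False d in simp)
  qed
next
  case (Alice I P)
  have I: "is_instrument dA I" using Alice.prems(1) by simp
  have \<Phi>: "\<Phi> \<in> carrier_mat dA dB" using Alice.prems by auto
  show ?case
  proof (rule half_bounded_Kraus[OF is_instrumentD(1,3)[OF I] \<Phi>])
    \<comment> \<open>Completeness concerns the operators of all outcomes together; each of them
      belongs to some outcome \<open>j\<close>, whose continuation supplies the induction
      hypothesis.\<close>
    fix K assume "K \<in> set (concat (map snd I))"
    then obtain j where j: "j < length I" and K: "K \<in> set (snd (I ! j))"
      by (auto simp: in_set_conv_nth[of _ I])
    let ?\<Psi>s = "concat (map (\<lambda>K. map (\<lambda>\<Phi>. K * \<Phi>) \<Phi>s) (snd (I ! j)))"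
    have Ks: "set (snd (I ! j)) \<subseteq> carrier_mat (fst (I ! j)) dA" by (rule is_instrumentD(2)[OF I j])
    show "half_bounded (K * \<Phi>)"
    proof (rule Alice.IH[of "P j"])
      show "locc_valid (P j) (fst (I ! j)) dB" using Alice.prems(1) j by simp
      show "set ?\<Psi>s \<subseteq> carrier_mat (fst (I ! j)) dB"
        using Ks Alice.prems(2) by (auto intro!: mult_carrier_mat)
      show "K * \<Phi> \<in> set ?\<Psi>s" using K Alice.prems(3) by auto
      have "locc_branches (P j) (fst (I ! j)) dB (mixture (fst (I ! j)) dB ?\<Psi>s)
        \<subseteq> locc_branches (Alice I P) dA dB (mixture dA dB \<Phi>s)"
        using j by (auto simp: kraus_map_Alice[OF Alice.prems(2) Ks])
      then show "\<forall>(dA', dB', \<sigma>) \<in> locc_branches (P j) (fst (I ! j)) dB (mixture (fst (I ! j)) dB ?\<Psi>s).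
        mat_trace \<sigma> \<noteq> 0 \<longrightarrow> (\<exists>m n. dA' = 2 * m \<and> dB' = 2 * n \<and>
          (1 / mat_trace \<sigma>) \<cdot>\<^sub>m reduced_AB m n \<sigma> = density bell_state)"
        using Alice.prems(4) by blast
    qed simp
  qed
next
  case (Bob I P)
  have I: "is_instrument dB I" using Bob.prems(1) by simp
  have \<Phi>: "\<Phi> \<in> carrier_mat dA dB" using Bob.prems by auto
  then have \<Phi>t: "transpose_mat \<Phi> \<in> carrier_mat dB dA" by simp
  \<comment> \<open>Bob's operators act from the right. Transposition turns them into operators from
    the left and preserves the bound.\<close>
  have "half_bounded (transpose_mat \<Phi>)"
  proof (rule half_bounded_Kraus[OF is_instrumentD(1,3)[OF I] \<Phi>t])
    fix K assume "K \<in> set (concat (map snd I))"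
    then obtain j where j: "j < length I" and K: "K \<in> set (snd (I ! j))"
      by (auto simp: in_set_conv_nth[of _ I])
    let ?\<Psi>s = "concat (map (\<lambda>K. map (\<lambda>\<Phi>. \<Phi> * transpose_mat K) \<Phi>s) (snd (I ! j)))"
    have Ks: "set (snd (I ! j)) \<subseteq> carrier_mat (fst (I ! j)) dB" by (rule is_instrumentD(2)[OF I j])
    then have Kc: "K \<in> carrier_mat (fst (I ! j)) dB" using K by auto
    have "half_bounded (\<Phi> * transpose_mat K)"
    proof (rule Bob.IH[of "P j"])
      show "locc_valid (P j) dA (fst (I ! j))" using Bob.prems(1) j by simp
      show "set ?\<Psi>s \<subseteq> carrier_mat dA (fst (I ! j))"
        using Ks Bob.prems(2) by (auto intro!: mult_carrier_mat)
      show "\<Phi> * transpose_mat K \<in> set ?\<Psi>s" using K Bob.prems(3) by auto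
      have "locc_branches (P j) dA (fst (I ! j)) (mixture dA (fst (I ! j)) ?\<Psi>s)
        \<subseteq> locc_branches (Bob I P) dA dB (mixture dA dB \<Phi>s)"
        using j by (auto simp: kraus_map_Bob[OF Bob.prems(2) Ks])
      then show "\<forall>(dA', dB', \<sigma>) \<in> locc_branches (P j) dA (fst (I ! j)) (mixture dA (fst (I ! j)) ?\<Psi>s).
        mat_trace \<sigma> \<noteq> 0 \<longrightarrow> (\<exists>m n. dA' = 2 * m \<and> dB' = 2 * n \<and>
          (1 / mat_trace \<sigma>) \<cdot>\<^sub>m reduced_AB m n \<sigma> = density bell_state)"
        using Bob.prems(4) by blast
    qed simp
    from half_bounded_transpose[OF this] show "half_bounded (K * transpose_mat \<Phi>)"
      using transpose_mult[OF \<Phi>, of "transpose_mat K"] Kc by simp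
  qed
  from half_bounded_transpose[OF this] show ?case by simp
qed

section \<open>The state after the Bank's measurement\<close>

definition link_coeff :: "real \<Rightarrow> complex mat" where
  "link_coeff \<theta> = mat 2 2 (\<lambda>(a, b). if a \<noteq> b then 0 else complex_of_real (if a = 0 then cos \<theta> else sin \<theta>))"

text \<open>Rows belong to \<open>A'\<close> and columns to \<open>B'\<close>. The amplitude
  \<open>a\<close> selects the terms with \<open>K = 0\<close>, carrying \<open>\<beta>\<close> and
  \<open>\<gamma>\<close>; \<open>b\<close> selects the term with \<open>K = 1\<close>, carrying
  \<open>\<alpha>\<close>.\<close>

definition W_coeff :: "real \<Rightarrow> real \<Rightarrow> real \<Rightarrow> complex \<Rightarrow> complex \<Rightarrow> complex mat" where
  "W_coeff \<alpha> \<beta> \<gamma> a b = mat 2 2 (\<lambda>(r, s). if r = 0 then if s = 0 then b * complex_of_real \<alpha> else a * complex_of_real \<beta>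
      else if s = 0 then a * complex_of_real \<gamma> else 0)"

text \<open>The state of Alice and Bob after the Bank projects \<open>K\<close> with the row vector \<open>(a, b)\<close>.\<close>

definition bank_coeff :: "real \<Rightarrow> real \<Rightarrow> real \<Rightarrow> real \<Rightarrow> complex \<Rightarrow> complex \<Rightarrow> complex mat" where
  "bank_coeff \<theta> \<alpha> \<beta> \<gamma> a b = link_coeff \<theta> \<otimes>\<^sub>m W_coeff \<alpha> \<beta> \<gamma> a b"

lemma bank_coeff_carrier [simp]: "bank_coeff \<theta> \<alpha> \<beta> \<gamma> a b \<in> carrier_mat 4 4"
  using kron_carrier[of "link_coeff \<theta>" 2 2 "W_coeff \<alpha> \<beta> \<gamma> a b" 2 2]
  by (simp add: bank_coeff_def link_coeff_def W_coeff_def)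

lemma bank_coeff_dim [simp]: "dim_row (bank_coeff \<theta> \<alpha> \<beta> \<gamma> a b) = 4" "dim_col (bank_coeff \<theta> \<alpha> \<beta> \<gamma> a b) = 4"
  using carrier_matD[OF bank_coeff_carrier] by blast+

lemma nat_less_4_cases: "(n::nat) < 4 \<Longrightarrow> n = 0 \<or> n = 1 \<or> n = 2 \<or> n = 3"
  by linarith

lemma nat_less_8_cases: "(n::nat) < 8 \<Longrightarrow> n = 0 \<or> n = 1 \<or> n = 2 \<or> n = 3 \<or> n = 4 \<or> n = 5 \<or> n = 6 \<or> n = 7"
  by linarith

lemma link_state_eq: "link_state \<theta> = mat 4 1 (\<lambda>(i, _). if i = 0 then complex_of_real (cos \<theta>)
    else if i = 3 then complex_of_real (sin \<theta>) else 0)"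
  by (rule eq_matI) (auto simp: link_state_def kron_def ket_def dest!: nat_less_4_cases)

lemma W_state_eq: "W_state \<alpha> \<beta> \<gamma> = mat 8 1 (\<lambda>(i, _). if i = 1 then complex_of_real \<alpha>
    else if i = 2 then complex_of_real \<beta> else if i = 4 then complex_of_real \<gamma> else 0)"
proof (rule eq_matI, goal_cases)
  case (1 i j)
  then have "i < 8" "j = 0" by simp_all
  from nat_less_8_cases[OF this(1)] this(2) show ?case
    by (elim disjE) (simp_all add: W_state_def kron_def ket_def)
qed (simp_all add: W_state_def kron_def ket_def)

text \<open>Takes an index in the order A A' B B' K to that of the same basis vector in the order A
  B A' B' K, by exchanging the bits of weight 8 and 4.\<close>

definition swap_index :: "nat \<Rightarrow> nat" where
  "swap_index i = i div 16 * 16 + i div 4 mod 2 * 8 + i div 8 mod 2 * 4 + i mod 4"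

text \<open>The last two bits stay together in \<open>d\<close>, since the reordering does not move
  them.\<close>

lemma five_bits:
  assumes "(i::nat) < 32"
  obtains a b c d where "i = 16 * a + 8 * b + 4 * c + d" "a < 2" "b < 2" "c < 2" "d < 4"
proof
  have "i div 4 div 2 = i div 8" "i div 8 div 2 = i div 16" by (simp_all flip: div_mult2_eq)
  then show "i = 16 * (i div 16) + 8 * (i div 8 mod 2) + 4 * (i div 4 mod 2) + i mod 4"
    using div_mult_mod_eq[of i 4] div_mult_mod_eq[of "i div 4" 2] div_mult_mod_eq[of "i div 8" 2] by linarith
qed (use assms in auto)

lemma digits:
  fixes a b c d :: nat
  assumes "a < 2" "b < 2" "c < 2" "d < 4"
  defines "i \<equiv> 16 * a + 8 * b + 4 * c + d"
  shows "i div 16 = a" "i div 8 mod 2 = b" "i div 4 mod 2 = c" "i mod 4 = d"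
    "i mod 16 div 4 div 2 = b" "i mod 16 div 4 mod 2 = c" "i < 32"
proof -
  have "a = 0 \<or> a = 1" "b = 0 \<or> b = 1" "c = 0 \<or> c = 1" "d = 0 \<or> d = 1 \<or> d = 2 \<or> d = 3"
    using assms(1-4) by linarith+
  then show "i div 16 = a" "i div 8 mod 2 = b" "i div 4 mod 2 = c" "i mod 4 = d"
    "i mod 16 div 4 div 2 = b" "i mod 16 div 4 mod 2 = c" "i < 32"
    unfolding i_def by (elim disjE; simp)+
qed

lemma swap_entry:
  assumes "i < 32" "j < 32"
  shows "(1\<^sub>m 2 \<otimes>\<^sub>m swap_qubits \<otimes>\<^sub>m 1\<^sub>m 4) $$ (i, j) = (if j = swap_index i then 1 else 0)"
proof -
  have carr: "swap_qubits \<in> carrier_mat 4 4" "(1\<^sub>m 4 :: complex mat) \<in> carrier_mat 4 4"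
    "(1\<^sub>m 2 :: complex mat) \<in> carrier_mat 2 2" by (auto simp: swap_qubits_def)
  have carr2: "swap_qubits \<otimes>\<^sub>m 1\<^sub>m 4 \<in> carrier_mat 16 16"
    using kron_carrier[OF carr(1,2)] by simp
  obtain a b c d where i: "i = 16 * a + 8 * b + 4 * c + d" "a < 2" "b < 2" "c < 2" "d < 4"
    using five_bits[OF assms(1)] .
  obtain a' b' c' d' where j: "j = 16 * a' + 8 * b' + 4 * c' + d'" "a' < 2" "b' < 2" "c' < 2" "d' < 4"
    using five_bits[OF assms(2)] .
  note di = digits[OF i(2-), folded i(1)] and dj = digits[OF j(2-), folded j(1)]
  have m: "i mod 16 mod 4 = d" "j mod 16 mod 4 = d'" using di(4) dj(4) by (simp_all add: mod_mod_cancel)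
  have "(1\<^sub>m 2 \<otimes>\<^sub>m swap_qubits \<otimes>\<^sub>m 1\<^sub>m 4) $$ (i, j)
    = 1\<^sub>m 2 $$ (i div 16, j div 16) * (swap_qubits \<otimes>\<^sub>m 1\<^sub>m 4) $$ (i mod 16, j mod 16)"
    by (rule kron_index[OF carr(3) carr2]) (use assms in auto)
  also have "(swap_qubits \<otimes>\<^sub>m 1\<^sub>m 4) $$ (i mod 16, j mod 16)
    = swap_qubits $$ (i mod 16 div 4, j mod 16 div 4) * 1\<^sub>m 4 $$ (i mod 16 mod 4, j mod 16 mod 4)"
    by (rule kron_index[OF carr(1,2)]) auto
  also have "1\<^sub>m 2 $$ (i div 16, j div 16) * \<dots> = (if a = a' \<and> b = c' \<and> c = b' \<and> d = d' then 1 else (0::complex))"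
  proof -
    have "i mod 16 div 4 < 4" "j mod 16 div 4 < 4" by auto
    then have "swap_qubits $$ (i mod 16 div 4, j mod 16 div 4) = (if b = c' \<and> c = b' then 1 else 0)"
      by (simp add: swap_qubits_def di(5,6) dj(5,6))
    moreover have "(1\<^sub>m 2 :: complex mat) $$ (a, a') = (if a = a' then 1 else 0)"
      "(1\<^sub>m 4 :: complex mat) $$ (d, d') = (if d = d' then 1 else 0)"
      using i(2,5) j(2,5) by simp_all
    ultimately show ?thesis unfolding m di(1) dj(1) by simp
  qed
  also have "\<dots> = (if j = swap_index i then 1 else 0)"
  proof -
    have "swap_index i = 16 * a + 8 * c + 4 * b + d"
      by (simp add: swap_index_def di)
    \<comment> \<open>Two equal indices have equal binary digits, here those of \<open>j\<close> and
      of \<open>swap_index i\<close>.\<close>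
    moreover from this have "a = a' \<and> b = c' \<and> c = b' \<and> d = d'" if "j = swap_index i"
      using digits[OF i(2) i(4) i(3) i(5)] that dj by metis
    ultimately show ?thesis using j(1) by auto
  qed
  finally show ?thesis .
qed

text \<open>Here the cut separates both parties from the Bank: rows carry the index of A A' B B',
  and column \<open>k\<close> is the vectorised state that belongs to \<open>K = k\<close>.\<close>

definition global_coeff :: "real \<Rightarrow> real \<Rightarrow> real \<Rightarrow> real \<Rightarrow> complex mat" where
  "global_coeff \<theta> \<alpha> \<beta> \<gamma> = mat 16 2 (\<lambda>(i, k).
     bank_coeff \<theta> \<alpha> \<beta> \<gamma> (if k = 0 then 1 else 0) (if k = 1 then 1 else 0) $$ (i div 4, i mod 4))"

lemma global_state_eq:
  "global_state (link_state \<theta>) (W_state \<alpha> \<beta> \<gamma>) = coeff_ket (global_coeff \<theta> \<alpha> \<beta> \<gamma>)"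
proof (rule eq_matI)
  let ?S = "1\<^sub>m 2 \<otimes>\<^sub>m swap_qubits \<otimes>\<^sub>m 1\<^sub>m 4" and ?v = "link_state \<theta> \<otimes>\<^sub>m W_state \<alpha> \<beta> \<gamma>"
  have S: "?S \<in> carrier_mat 32 32"
    by (auto simp: kron_def swap_qubits_def)
  have l: "link_state \<theta> \<in> carrier_mat 4 1" and w: "W_state \<alpha> \<beta> \<gamma> \<in> carrier_mat 8 1"
    by (simp_all add: link_state_eq W_state_eq)
  have v: "?v \<in> carrier_mat 32 1" using kron_carrier[OF l w] by simp
  have G: "global_coeff \<theta> \<alpha> \<beta> \<gamma> \<in> carrier_mat 16 2" by (simp add: global_coeff_def)
  show "dim_row (global_state (link_state \<theta>) (W_state \<alpha> \<beta> \<gamma>)) = dim_row (coeff_ket (global_coeff \<theta> \<alpha> \<beta> \<gamma>))"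
    "dim_col (global_state (link_state \<theta>) (W_state \<alpha> \<beta> \<gamma>)) = dim_col (coeff_ket (global_coeff \<theta> \<alpha> \<beta> \<gamma>))"
    using S v coeff_ket_carrier[OF G] by (auto simp: global_state_def)
  fix i j assume "i < dim_row (coeff_ket (global_coeff \<theta> \<alpha> \<beta> \<gamma>))" "j < dim_col (coeff_ket (global_coeff \<theta> \<alpha> \<beta> \<gamma>))"
  then have i: "i < 32" and j: "j = 0" using coeff_ket_carrier[OF G] by auto
  obtain a b c d where abcd: "i = 16 * a + 8 * b + 4 * c + d" "a < 2" "b < 2" "c < 2" "d < 4"
    using five_bits[OF i] .
  have si: "swap_index i = 16 * a + 8 * c + 4 * b + d"
    by (simp add: swap_index_def digits[OF abcd(2-)] abcd(1))
  have lt: "swap_index i < 32" unfolding si by (rule digits(7)[OF abcd(2) abcd(4) abcd(3) abcd(5)])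
  have "(?S * ?v) $$ (i, 0) = (\<Sum>k<32. ?S $$ (i, k) * ?v $$ (k, 0))"
    by (rule index_mult_mat_sum[OF S v i]) simp
  also have "\<dots> = (\<Sum>k<32. if k = swap_index i then ?v $$ (k, 0) else 0)"
    by (rule sum.cong) (use i in \<open>auto simp: swap_entry\<close>)
  also have "\<dots> = ?v $$ (swap_index i, 0)" using lt by simp
  also have "\<dots> = link_state \<theta> $$ (swap_index i div 8, 0 div 1) * W_state \<alpha> \<beta> \<gamma> $$ (swap_index i mod 8, 0 mod 1)"
    by (rule kron_index[OF l w]) (use lt in auto)
  also have "\<dots> = coeff_ket (global_coeff \<theta> \<alpha> \<beta> \<gamma>) $$ (i, 0)"
  proof -
    have "coeff_ket (global_coeff \<theta> \<alpha> \<beta> \<gamma>) $$ (i, 0) = global_coeff \<theta> \<alpha> \<beta> \<gamma> $$ (i div 2, i mod 2)"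
      by (rule coeff_ket_index[OF G]) (use i in simp)
    moreover have "a = 0 \<or> a = 1" "b = 0 \<or> b = 1" "c = 0 \<or> c = 1" "d = 0 \<or> d = 1 \<or> d = 2 \<or> d = 3"
      using abcd by linarith+
    ultimately show ?thesis
      unfolding si unfolding abcd(1)
      by (elim disjE) (simp_all add: link_state_eq W_state_eq global_coeff_def bank_coeff_def kron_def link_coeff_def W_coeff_def)
  qed
  finally show "global_state (link_state \<theta>) (W_state \<alpha> \<beta> \<gamma>) $$ (i, j) = coeff_ket (global_coeff \<theta> \<alpha> \<beta> \<gamma>) $$ (i, j)"
    by (simp add: global_state_def j)
qed

text \<open>\<open>M\<close> acts on \<open>K\<close> by right multiplication with its transpose.
  Tracing out \<open>K\<close> afterwards leaves an incoherent mixture with one component for each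
  row of \<open>M\<close>.\<close>

lemma bank_outcome_state_eq:
  assumes M: "M \<in> carrier_mat 2 2"
  shows "bank_outcome_state M (density (global_state (link_state \<theta>) (W_state \<alpha> \<beta> \<gamma>)))
    = mixture 4 4 [bank_coeff \<theta> \<alpha> \<beta> \<gamma> (M $$ (0, 0)) (M $$ (0, 1)), bank_coeff \<theta> \<alpha> \<beta> \<gamma> (M $$ (1, 0)) (M $$ (1, 1))]"
proof (rule eq_matI)
  let ?\<Phi> = "\<lambda>k. bank_coeff \<theta> \<alpha> \<beta> \<gamma> (M $$ (k, 0)) (M $$ (k, 1))"
  let ?G = "global_coeff \<theta> \<alpha> \<beta> \<gamma>"
  have Mt: "transpose_mat M \<in> carrier_mat 2 2" using M by simp
  have G: "?G \<in> carrier_mat 16 2" by (simp add: global_coeff_def)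
  have GM: "?G * transpose_mat M \<in> carrier_mat 16 2" using G M by simp
  have K: "1\<^sub>m 16 \<otimes>\<^sub>m M \<in> carrier_mat 32 32" using kron_carrier[OF one_carrier_mat[of 16] M] by simp
  have cG: "coeff_ket ?G \<in> carrier_mat 32 1" using coeff_ket_carrier[OF G] by simp
  have cGM: "coeff_ket (?G * transpose_mat M) \<in> carrier_mat 32 1" using coeff_ket_carrier[OF GM] by simp
  have "kraus_map 32 [1\<^sub>m 16 \<otimes>\<^sub>m M] (density (coeff_ket ?G)) = density (coeff_ket (?G * transpose_mat M))"
    using density_conj[OF K cG] right_add_zero_mat[OF density_carrier[OF cGM]]
    by (simp add: kraus_map_def one_kron_coeff_ket[OF M G])
  then have eq: "bank_outcome_state M (density (global_state (link_state \<theta>) (W_state \<alpha> \<beta> \<gamma>)))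
    = ptrace_snd 16 2 (density (coeff_ket (?G * transpose_mat M)))"
    by (simp add: bank_outcome_state_def global_state_eq)
  have carr: "set [?\<Phi> 0, ?\<Phi> 1] \<subseteq> carrier_mat 4 4" by simp
  note mc = mixture_carrier[OF carr]
  show "dim_row (bank_outcome_state M (density (global_state (link_state \<theta>) (W_state \<alpha> \<beta> \<gamma>)))) = dim_row (mixture 4 4 [?\<Phi> 0, ?\<Phi> 1])"
    "dim_col (bank_outcome_state M (density (global_state (link_state \<theta>) (W_state \<alpha> \<beta> \<gamma>)))) = dim_col (mixture 4 4 [?\<Phi> 0, ?\<Phi> 1])"
    using mc by (auto simp: bank_outcome_state_def ptrace_snd_def)
  fix i j assume "i < dim_row (mixture 4 4 [?\<Phi> 0, ?\<Phi> 1])" "j < dim_col (mixture 4 4 [?\<Phi> 0, ?\<Phi> 1])"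
  then have i: "i < 16" and j: "j < 16" using mc by auto
  \<comment> \<open>\<open>bank_coeff\<close> is linear in the Bank's amplitudes, so a row of
    \<open>M\<close> combines the two columns of \<open>global_coeff\<close>.\<close>
  have amp: "(?G * transpose_mat M) $$ (n, k) = ?\<Phi> k $$ (n div 4, n mod 4)" if n: "n < 16" and k: "k < 2" for n k
  proof -
    have "(?G * transpose_mat M) $$ (n, k) = ?G $$ (n, 0) * M $$ (k, 0) + ?G $$ (n, 1) * M $$ (k, 1)"
      using M n k by (simp only: index_mult_mat_sum[OF G Mt n k]) (simp add: numeral_2_eq_2)
    also have "\<dots> = ?\<Phi> k $$ (n div 4, n mod 4)"
      using n by (auto simp: global_coeff_def bank_coeff_def kron_def link_coeff_def W_coeff_def
          less_mult_imp_div_less algebra_simps)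
    finally show ?thesis .
  qed
  have ent: "coeff_ket (?G * transpose_mat M) $$ (n * 2 + k, 0) = ?\<Phi> k $$ (n div 4, n mod 4)" if "n < 16" "k < 2" for n k
    using that coeff_ket_index[OF GM, of "n * 2 + k"] amp[OF that] by simp
  have "bank_outcome_state M (density (global_state (link_state \<theta>) (W_state \<alpha> \<beta> \<gamma>))) $$ (i, j)
    = (\<Sum>k<2. density (coeff_ket (?G * transpose_mat M)) $$ (i * 2 + k, j * 2 + k))"
    unfolding eq ptrace_snd_def using i j by simp
  also have "\<dots> = (\<Sum>k<2. ?\<Phi> k $$ (i div 4, i mod 4) * cnj (?\<Phi> k $$ (j div 4, j mod 4)))"
    by (intro sum.cong refl, subst density_index[OF cGM]) (use i j in \<open>auto simp: ent simp del: One_nat_def\<close>)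
  also have "\<dots> = mixture 4 4 [?\<Phi> 0, ?\<Phi> 1] $$ (i, j)"
    using i j by (subst mixture_index[OF carr]) (auto simp: numeral_2_eq_2)
  finally show "bank_outcome_state M (density (global_state (link_state \<theta>) (W_state \<alpha> \<beta> \<gamma>))) $$ (i, j)
    = mixture 4 4 [?\<Phi> 0, ?\<Phi> 1] $$ (i, j)" .
qed

section \<open>Necessity\<close>

lemma sum_lessThan_4: "(\<Sum>i<(4::nat). f i) = f 0 + f 1 + f 2 + (f 3 :: 'a::comm_monoid_add)"
  by (simp add: eval_nat_numeral add.assoc)

text \<open>By hypothesis, \<open>T\<close> times the identity minus the Gram matrix of the matrix
  with rows \<open>(u, v)\<close> and \<open>(w, 0)\<close> is positive semidefinite. The conclusion
  says that its determinant is nonnegative.\<close>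

lemma quadratic_form_det:
  fixes u v w :: complex and T :: real
  assumes bound: "\<And>x\<^sub>0 x\<^sub>1. (cmod (u * x\<^sub>0 + v * x\<^sub>1))\<^sup>2 + (cmod (w * x\<^sub>0))\<^sup>2 \<le> T * ((cmod x\<^sub>0)\<^sup>2 + (cmod x\<^sub>1)\<^sup>2)"
  shows "T * ((cmod u)\<^sup>2 + (cmod v)\<^sup>2 + (cmod w)\<^sup>2) - T\<^sup>2 \<le> (cmod v)\<^sup>2 * (cmod w)\<^sup>2"
proof -
  define U V W where "U = (cmod u)\<^sup>2" and "V = (cmod v)\<^sup>2" and "W = (cmod w)\<^sup>2"
  have P: "0 \<le> T - U - W" using bound[of 1 0] by (simp add: U_def W_def)
  have R: "0 \<le> T - V" using bound[of 0 1] by (simp add: V_def)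
  have "U * V \<le> (T - U - W) * (T - V)"
  proof (cases "U = 0 \<or> V = 0")
    case True
    then show ?thesis using P R by auto
  next
    case False
    then have UV: "U > 0" "V > 0" by (auto simp: U_def V_def)
    \<comment> \<open>Division by \<open>U\<close> and \<open>V\<close> reduces the claim to
      \<open>1 \<le> r * p\<close>.\<close>
    define p r where "p = (T - U - W) / U" and "r = (T - V) / V"
    have pr: "0 \<le> p" "0 \<le> r" using P R UV by (simp_all add: p_def r_def)
    \<comment> \<open>The test vector is chosen so that \<open>u\<close> and \<open>v\<close> times
      its entries are the real numbers \<open>X\<close> and \<open>Y\<close>; this removes the
      phases.\<close>
    have form: "2 * X * Y \<le> p * X\<^sup>2 + r * Y\<^sup>2" for X Y :: real
    proof -
      have "u * cnj u = complex_of_real U" "v * cnj v = complex_of_real V"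
        by (simp_all add: U_def V_def complex_norm_square del: of_real_power)
      then have "u * (cnj u * complex_of_real (X / U)) = complex_of_real X"
        "v * (cnj v * complex_of_real (Y / V)) = complex_of_real Y"
        using UV by (simp_all add: mult.assoc[symmetric])
      then have "u * (cnj u * complex_of_real (X / U)) + v * (cnj v * complex_of_real (Y / V)) = complex_of_real (X + Y)"
        by simp
      moreover have "(cmod (cnj u * complex_of_real (X / U)))\<^sup>2 = X\<^sup>2 / U" "(cmod (cnj v * complex_of_real (Y / V)))\<^sup>2 = Y\<^sup>2 / V"
        "(cmod (w * (cnj u * complex_of_real (X / U))))\<^sup>2 = W * X\<^sup>2 / U"
        using UV by (simp_all add: norm_mult norm_divide power_mult_distrib power_divide U_def[symmetric] V_def[symmetric] W_def[symmetric] power2_eq_square[of U] power2_eq_square[of V])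
      ultimately have "(X + Y)\<^sup>2 + W * X\<^sup>2 / U \<le> T * (X\<^sup>2 / U + Y\<^sup>2 / V)"
        using bound[of "cnj u * complex_of_real (X / U)" "cnj v * complex_of_real (Y / V)"] by (simp only: norm_of_real power2_abs)
      moreover have "p * X\<^sup>2 = T * (X\<^sup>2 / U) - X\<^sup>2 - W * X\<^sup>2 / U" "r * Y\<^sup>2 = T * (Y\<^sup>2 / V) - Y\<^sup>2"
        using UV by (simp_all add: p_def r_def field_simps)
      ultimately show ?thesis by (simp add: power2_sum distrib_left)
    qed
    \<comment> \<open>For \<open>p = 0\<close> the form would give
      \<open>2 * (r + 1) \<le> r\<close>.\<close>
    have "p \<noteq> 0" using form[of "r + 1" 1] pr by auto
    \<comment> \<open>The form gives \<open>2 * p \<le> p + r * p\<^sup>2\<close>, in which the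
      positive \<open>p\<close> cancels.\<close>
    then have "1 \<le> r * p"
      using form[of 1 p] pr by (simp add: power2_eq_square)
    then show ?thesis using UV by (simp add: p_def r_def field_simps)
  qed
  then show ?thesis unfolding U_def[symmetric] V_def[symmetric] W_def[symmetric]
    by (simp add: power2_eq_square algebra_simps)
qed

text \<open>Vectors with \<open>B = 0\<close> isolate the block of the state weighted by
  \<open>cos \<theta>\<close>. The determinant inequality for this block is the claim.\<close>

lemma bank_coeff_half_bounded:
  fixes a b :: complex
  assumes half: "half_bounded (bank_coeff \<theta> \<alpha> \<beta> \<gamma> a b)" and c: "cos \<theta> > 0"
  defines "N \<equiv> (cmod b)\<^sup>2 * \<alpha>\<^sup>2 + (cmod a)\<^sup>2 * (\<beta>\<^sup>2 + \<gamma>\<^sup>2)"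
  shows "N\<^sup>2 * (1 - tan \<theta> ^ 4) \<le> (2 * (cmod a)\<^sup>2 * \<beta> * \<gamma>)\<^sup>2"
proof -
  let ?\<Phi> = "bank_coeff \<theta> \<alpha> \<beta> \<gamma> a b"
  have dims: "dim_row ?\<Phi> = 4" "dim_col ?\<Phi> = 4" using bank_coeff_carrier[of \<theta> \<alpha> \<beta> \<gamma> a b] by blast+
  have "frob2 ?\<Phi> = (cos \<theta>)\<^sup>2 * N + (sin \<theta>)\<^sup>2 * N"
    unfolding frob2_def dims sum_lessThan_4
    by (simp add: bank_coeff_def kron_def link_coeff_def W_coeff_def norm_mult power_mult_distrib N_def algebra_simps)
  also have "\<dots> = N" by (simp add: distrib_right[symmetric])
  finally have frob: "frob2 ?\<Phi> = N" .
  \<comment> \<open>Half the squared norm, with the weight \<open>(cos \<theta>)\<^sup>2\<close> of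
    the block divided out.\<close>
  define T where "T = N / (2 * (cos \<theta>)\<^sup>2)"
  have "(cmod (b * \<alpha> * x\<^sub>0 + a * \<beta> * x\<^sub>1))\<^sup>2 + (cmod (a * \<gamma> * x\<^sub>0))\<^sup>2 \<le> T * ((cmod x\<^sub>0)\<^sup>2 + (cmod x\<^sub>1)\<^sup>2)" for x\<^sub>0 x\<^sub>1
  proof -
    have "(cmod (cos \<theta> * (b * \<alpha> * x\<^sub>0 + a * \<beta> * x\<^sub>1)))\<^sup>2 + (cmod (cos \<theta> * (a * \<gamma> * x\<^sub>0)))\<^sup>2
      \<le> N / 2 * ((cmod x\<^sub>0)\<^sup>2 + (cmod x\<^sub>1)\<^sup>2)"
      using half_bounded_image[OF half, of "\<lambda>j. if j = 0 then x\<^sub>0 else if j = 1 then x\<^sub>1 else 0"]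
      unfolding frob dims sum_lessThan_4
      by (simp add: bank_coeff_def kron_def link_coeff_def W_coeff_def distrib_left mult.assoc)
    then have "(cos \<theta>)\<^sup>2 * (cmod (b * \<alpha> * x\<^sub>0 + a * \<beta> * x\<^sub>1))\<^sup>2 + (cos \<theta>)\<^sup>2 * (cmod (a * \<gamma> * x\<^sub>0))\<^sup>2
      \<le> N / 2 * ((cmod x\<^sub>0)\<^sup>2 + (cmod x\<^sub>1)\<^sup>2)"
      by (simp only: norm_mult[of "complex_of_real (cos \<theta>)"] norm_of_real power_mult_distrib power2_abs)
    moreover have "p + q \<le> N / (2 * k) * Q" if "k * p + k * q \<le> N / 2 * Q" "k > 0" for p q k Q :: real
      using that by (simp add: field_simps)
    ultimately show ?thesis using c unfolding T_def by simp
  qed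
  from quadratic_form_det[OF this]
  have "T * N - T\<^sup>2 \<le> (cmod a)\<^sup>2 * \<beta>\<^sup>2 * ((cmod a)\<^sup>2 * \<gamma>\<^sup>2)"
    by (simp add: norm_mult power_mult_distrib N_def algebra_simps)
  \<comment> \<open>With \<open>k\<close> as below, both sides equal
    \<open>N\<^sup>2 * (2 * k - k\<^sup>2)\<close>, because
    \<open>(tan \<theta>)\<^sup>2 = k - 1\<close>.\<close>
  moreover have "4 * (T * N - T\<^sup>2) = N\<^sup>2 * (1 - tan \<theta> ^ 4)"
  proof -
    define k where "k = 1 / (cos \<theta>)\<^sup>2"
    have "(tan \<theta>)\<^sup>2 = k - 1"
      using c by (simp add: k_def tan_def power_divide sin_squared_eq diff_divide_distrib)
    then have tan4: "tan \<theta> ^ 4 = (k - 1)\<^sup>2" by (metis numeral_Bit0 power2_eq_square power_add)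
    have T: "T = N * k / 2" by (simp add: T_def k_def)
    show ?thesis unfolding tan4 T by (simp add: power2_eq_square algebra_simps)
  qed
  ultimately show ?thesis by (simp add: power2_eq_square algebra_simps)
qed

text \<open>Makes the root \<open>S\<close> in \<open>restorable_imp_bound\<close> that of a
  nonnegative number.\<close>

lemma tan_fourth_le_1:
  assumes "0 < \<theta>" "\<theta> \<le> pi / 4"
  shows "tan \<theta> ^ 4 \<le> 1"
proof -
  have "0 \<le> tan \<theta>" using assms by (intro less_imp_le tan_gt_zero) auto
  moreover have "tan \<theta> \<le> tan (pi / 4)"
  proof (cases "\<theta> = pi / 4")
    case False
    then show ?thesis using assms tan_monotone[of \<theta> "pi / 4"] by simp
  qed (simp only:)
  ultimately show ?thesis by (simp add: tan_45 power_le_one)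
qed

text \<open>After taking square roots, the bound of a component is linear in the squared moduli of
  its Bank amplitudes. By completeness these add up to 1 for each basis state of \<open>K\<close>,
  so summation removes the measurement from the inequality.\<close>

lemma restorable_imp_bound:
  fixes \<theta> \<alpha> \<beta> \<gamma> :: real
  assumes \<theta>: "0 < \<theta>" "\<theta> \<le> pi / 4"
    and pos: "\<beta> > 0" "\<gamma> > 0"
    and norm: "\<alpha>\<^sup>2 + \<beta>\<^sup>2 + \<gamma>\<^sup>2 = 1"
    and rest: "bank_measures_restorable (link_state \<theta>) (W_state \<alpha> \<beta> \<gamma>)"
  shows "1 - tan \<theta> ^ 4 \<le> 4 * \<beta>\<^sup>2 * \<gamma>\<^sup>2"
proof -
  obtain Ms P where Ms: "is_measurement 2 Ms"
    and P: "\<And>k. k < length Ms \<Longrightarrow> locc_valid (P k) 4 4 \<and>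
      restores_bell (P k) (bank_outcome_state (Ms ! k) (density (global_state (link_state \<theta>) (W_state \<alpha> \<beta> \<gamma>))))"
    using rest by (auto simp: bank_measures_restorable_def)
  define S where "S = sqrt (1 - tan \<theta> ^ 4)"
  have S: "0 \<le> S" "S\<^sup>2 = 1 - tan \<theta> ^ 4" using tan_fourth_le_1[OF \<theta>] by (simp_all add: S_def)
  have c: "cos \<theta> > 0" using \<theta> by (intro cos_gt_zero_pi) auto
  have carr: "M \<in> carrier_mat 2 2" if "M \<in> set Ms" for M
    using Ms that by (auto simp: is_measurement_def)
  have carr': "M \<in> carrier_mat (dim_row M) 2" if "M \<in> set Ms" for M
    using carr[OF that] by auto
  define f where "f l M = (cmod (M $$ (0, l)))\<^sup>2 + (cmod (M $$ (1, l)))\<^sup>2" for l :: nat and M :: "complex mat"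
  \<comment> \<open>\<open>f l M\<close> is the squared norm of column \<open>l\<close> of
    \<open>M\<close>; conservation of norm is applied to basis vector \<open>l\<close>.\<close>
  have total: "(\<Sum>M\<leftarrow>Ms. f l M) = 1" if "l < 2" for l
  proof -
    have "(\<Sum>M\<leftarrow>Ms. \<Sum>i<dim_row M. (cmod (\<Sum>k<2. M $$ (i, k) * (if k = l then 1 else 0)))\<^sup>2)
      = (\<Sum>k<2. (cmod (if k = l then 1 else 0))\<^sup>2)"
      by (rule complete_Kraus_norm[OF carr']) (use Ms in \<open>auto simp: is_measurement_def\<close>)
    also have "\<dots> = 1" using that by (auto simp: numeral_2_eq_2 less_Suc_eq)
    also have "(\<Sum>M\<leftarrow>Ms. \<Sum>i<dim_row M. (cmod (\<Sum>k<2. M $$ (i, k) * (if k = l then 1 else 0)))\<^sup>2) = (\<Sum>M\<leftarrow>Ms. f l M)"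
    proof (intro arg_cong[where f = sum_list] map_cong refl)
      fix M assume "M \<in> set Ms"
      then have "dim_row M = 2" using carr by auto
      then show "(\<Sum>i<dim_row M. (cmod (\<Sum>k<2. M $$ (i, k) * (if k = l then 1 else 0)))\<^sup>2) = f l M"
        using that by (auto simp: f_def numeral_2_eq_2 less_Suc_eq)
    qed
    finally show ?thesis .
  qed
  have row: "S * ((cmod b)\<^sup>2 * \<alpha>\<^sup>2 + (cmod a)\<^sup>2 * (\<beta>\<^sup>2 + \<gamma>\<^sup>2)) \<le> 2 * (cmod a)\<^sup>2 * \<beta> * \<gamma>"
    if "half_bounded (bank_coeff \<theta> \<alpha> \<beta> \<gamma> a b)" for a b
  proof (rule power2_le_imp_le)
    show "(S * ((cmod b)\<^sup>2 * \<alpha>\<^sup>2 + (cmod a)\<^sup>2 * (\<beta>\<^sup>2 + \<gamma>\<^sup>2)))\<^sup>2 \<le> (2 * (cmod a)\<^sup>2 * \<beta> * \<gamma>)\<^sup>2"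
      using bank_coeff_half_bounded[OF that c] by (simp add: power_mult_distrib S(2) mult.commute)
    show "0 \<le> 2 * (cmod a)\<^sup>2 * \<beta> * \<gamma>" using pos by simp
  qed
  \<comment> \<open>The two rows of \<open>M\<close> give the two components of this outcome; their
    bounds are added.\<close>
  have each: "S * \<alpha>\<^sup>2 * f 1 M + S * (\<beta>\<^sup>2 + \<gamma>\<^sup>2) * f 0 M \<le> 2 * \<beta> * \<gamma> * f 0 M" if M: "M \<in> set Ms" for M
  proof -
    obtain k where k: "k < length Ms" "Ms ! k = M" using M by (auto simp: in_set_conv_nth)
    let ?\<Phi>s = "[bank_coeff \<theta> \<alpha> \<beta> \<gamma> (M $$ (0, 0)) (M $$ (0, 1)), bank_coeff \<theta> \<alpha> \<beta> \<gamma> (M $$ (1, 0)) (M $$ (1, 1))]"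
    have valid: "locc_valid (P k) 4 4" and restores: "restores_bell (P k) (mixture 4 4 ?\<Phi>s)"
      using P[OF k(1)] unfolding k(2) bank_outcome_state_eq[OF carr[OF M]] by auto
    have half: "half_bounded \<Phi>" if "\<Phi> \<in> set ?\<Phi>s" for \<Phi>
      by (rule half_bounded_of_restoring[OF valid _ that restores[unfolded restores_bell_def]]) simp
    show ?thesis
      using row[OF half, of "M $$ (0, 0)" "M $$ (0, 1)"] row[OF half, of "M $$ (1, 0)" "M $$ (1, 1)"]
      by (simp add: f_def algebra_simps)
  qed
  have "(\<Sum>M\<leftarrow>Ms. S * \<alpha>\<^sup>2 * f 1 M + S * (\<beta>\<^sup>2 + \<gamma>\<^sup>2) * f 0 M) \<le> (\<Sum>M\<leftarrow>Ms. 2 * \<beta> * \<gamma> * f 0 M)"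
    by (rule sum_list_mono) (rule each)
  then have "S * \<alpha>\<^sup>2 + S * (\<beta>\<^sup>2 + \<gamma>\<^sup>2) \<le> 2 * \<beta> * \<gamma>"
    by (simp only: sum_list_addf sum_list_const_mult total zero_less_numeral one_less_numeral_iff num.simps mult_1_right semiring_norm)
  then have "S \<le> 2 * \<beta> * \<gamma>"
    using norm by (simp add: distrib_left[symmetric] add.assoc)
  then have "S\<^sup>2 \<le> (2 * \<beta> * \<gamma>)\<^sup>2" using S(1) by (rule power_mono)
  then show ?thesis unfolding S(2) by (simp add: power_mult_distrib)
qed

section \<open>Distillation by a mixture of pairs\<close>

lemma mat_adjoint_adjoint [simp]: "mat_adjoint (mat_adjoint A) = (A :: complex mat)"
  by (rule eq_matI) auto

text \<open>Reduces completeness of a selection preceded by a fixed operator \<open>Z\<close> to the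
  sum for the selection alone; \<open>Z\<close> is \<open>Y\<close> for Alice and \<open>V\<close>
  for Bob in \<open>distillable\<close>.\<close>

lemma mat_sum_Gram_mult:
  assumes Z: "Z \<in> carrier_mat n d" and Ss: "set Ss \<subseteq> carrier_mat m n"
  shows "mat_sum d (map (\<lambda>S. mat_adjoint (S * Z) * (S * Z)) Ss)
    = mat_adjoint Z * mat_sum n (map (\<lambda>S. mat_adjoint S * S) Ss) * Z"
proof -
  have Zd: "mat_adjoint Z \<in> carrier_mat d n" using Z by simp
  have each: "mat_adjoint (S * Z) * (S * Z) = mat_adjoint Z * (mat_adjoint S * S) * Z" if "S \<in> set Ss" for S
  proof -
    have S: "S \<in> carrier_mat m n" and Sd: "mat_adjoint S \<in> carrier_mat n m" using subsetD[OF Ss that] by auto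
    have SZ: "S * Z \<in> carrier_mat m d" and SS: "mat_adjoint S * S \<in> carrier_mat n n" using S Sd Z by auto
    show ?thesis
      unfolding mat_adjoint_mult[OF S Z] assoc_mult_mat[OF Zd Sd SZ] assoc_mult_mat[OF Zd SS Z]
        assoc_mult_mat[OF Sd S Z] ..
  qed
  have "set (map (\<lambda>S. mat_adjoint S * S) Ss) \<subseteq> carrier_mat n n"
    unfolding set_map using mult_carrier_mat[OF mat_adjoint_carrier[OF subsetD[OF Ss]] subsetD[OF Ss]] by blast
  from mat_sum_conj[OF Zd this] show ?thesis
    by (simp add: o_def each cong: map_cong)
qed

text \<open>The operator c |0><p| + c |1><r|, which carries two levels onto a qubit.\<close>

definition select :: "complex \<Rightarrow> nat \<Rightarrow> nat \<Rightarrow> complex mat" where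
  "select c p r = mat 2 4 (\<lambda>(i, j). if j = (if i = 0 then p else r) then c else 0)"

lemma select_carrier [simp]: "select c p r \<in> carrier_mat 2 4"
  by (simp add: select_def)

lemma select_mult_transpose:
  assumes "p < 4" "r < 4" "p' < 4" "r' < 4"
  shows "select c p r * transpose_mat (select 1 p' r')
    = mat 2 2 (\<lambda>(i, j). if (if i = 0 then p else r) = (if j = 0 then p' else r') then c else 0)"
proof (rule eq_matI, goal_cases)
  case (1 i j)
  then have ij: "i < 2" "j < 2" by simp_all
  have St: "transpose_mat (select 1 p' r') \<in> carrier_mat 4 2" by simp
  have "(select c p r * transpose_mat (select 1 p' r')) $$ (i, j)
    = (\<Sum>l<4. if l = (if i = 0 then p else r) then (if l = (if j = 0 then p' else r') then c else 0) else 0)"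
    unfolding index_mult_mat_sum[OF select_carrier St ij] using ij by (intro sum.cong) (auto simp: select_def)
  then show ?case using ij assms by simp
qed (simp_all add: select_def)

lemma select_Gram:
  assumes "p < 4" "r < 4" "p \<noteq> r"
  shows "mat_adjoint (select c p r) * select c p r
    = mat 4 4 (\<lambda>(i, j). if i = j \<and> i \<in> {p, r} then c * cnj c else 0)"
proof (rule eq_matI, goal_cases)
  case (1 i j)
  then have ij: "i < 4" "j < 4" by simp_all
  have "(mat_adjoint (select c p r) * select c p r) $$ (i, j)
    = (\<Sum>l<2. mat_adjoint (select c p r) $$ (i, l) * select c p r $$ (l, j))"
    by (rule index_mult_mat_sum[OF mat_adjoint_carrier[OF select_carrier] select_carrier ij])
  then show ?case using ij assms by (auto simp: numeral_2_eq_2 select_def)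
qed (simp_all add: select_def)

text \<open>A multiple of the 2x2 identity is the coefficient matrix of an unnormalised Bell state.
  The zero component comes from Bob's second Kraus operator in \<open>distillable\<close>.\<close>

lemma bell_branch:
  assumes "mat_trace (mixture 2 2 [c \<cdot>\<^sub>m 1\<^sub>m 2, 0\<^sub>m 2 2]) \<noteq> 0"
  shows "(1 / mat_trace (mixture 2 2 [c \<cdot>\<^sub>m 1\<^sub>m 2, 0\<^sub>m 2 2])) \<cdot>\<^sub>m
    reduced_AB 1 1 (mixture 2 2 [c \<cdot>\<^sub>m 1\<^sub>m 2, 0\<^sub>m 2 2]) = density bell_state"
proof (rule eq_matI)
  let ?\<Phi>s = "[c \<cdot>\<^sub>m 1\<^sub>m 2, 0\<^sub>m 2 2] :: complex mat list"
  let ?\<sigma> = "mixture 2 2 ?\<Phi>s"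
  have carr: "set ?\<Phi>s \<subseteq> carrier_mat 2 2" and carr1: "set ?\<Phi>s \<subseteq> carrier_mat (2 * 1) (2 * 1)" by auto
  have "mat_trace ?\<sigma> = 2 * complex_of_real ((cmod c)\<^sup>2)"
    unfolding mixture_trace[OF carr] by (simp add: frob2_def numeral_2_eq_2 del: of_real_power)
  then have tr: "mat_trace ?\<sigma> = 2 * (c * cnj c)" by (simp add: complex_norm_square del: of_real_power)
  have "dim_row (density bell_state) = 4" "dim_col (density bell_state) = 4" using density_bell_carrier by auto
  then show "dim_row ((1 / mat_trace ?\<sigma>) \<cdot>\<^sub>m reduced_AB 1 1 ?\<sigma>) = dim_row (density bell_state)"
    "dim_col ((1 / mat_trace ?\<sigma>) \<cdot>\<^sub>m reduced_AB 1 1 ?\<sigma>) = dim_col (density bell_state)"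
    by (simp_all add: reduced_AB_def)
  fix i j assume "i < dim_row (density bell_state)" "j < dim_col (density bell_state)"
  then have ij: "i < 4" "j < 4" using density_bell_carrier by auto
  have "reduced_AB 1 1 ?\<sigma> $$ (i, j) = (if i \<in> {0, 3} \<and> j \<in> {0, 3} then c * cnj c else 0)"
    using reduced_AB_mixture[OF carr1 ij] nat_less_4_cases[OF ij(1)] nat_less_4_cases[OF ij(2)]
    by (elim disjE) simp_all
  then show "((1 / mat_trace ?\<sigma>) \<cdot>\<^sub>m reduced_AB 1 1 ?\<sigma>) $$ (i, j) = density bell_state $$ (i, j)"
    using ij assms unfolding density_bell_index[OF ij] tr by (simp add: reduced_AB_def)
qed

text \<open>\<open>X * V\<close> acts as a Schmidt decomposition: the columns of \<open>X\<close>
  are orthogonal with squared norms \<open>l i\<close>, and \<open>V\<close> is a real change of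
  basis for Bob. Alice inverts \<open>X\<close> and selects a pair of levels; her operators are
  complete because the weighted projections onto the pairs add up to the Gram matrix of
  \<open>X\<close>. The inequalities state that the pair weights other than \<open>l 3\<close> are
  nonnegative.\<close>

lemma distillable:
  fixes X V :: "complex mat" and l :: "nat \<Rightarrow> real"
  assumes X: "X \<in> carrier_mat 4 4" and V: "V \<in> carrier_mat 4 4"
    and V_real: "mat_adjoint V = transpose_mat V" and V_orth: "V * transpose_mat V = 1\<^sub>m 4"
    and Gram: "mat_adjoint X * X = mat 4 4 (\<lambda>(i, j). if i = j then complex_of_real (l i) else 0)"
    and pos: "\<And>i. i < 4 \<Longrightarrow> 0 < l i"
    and ineq: "l 0 \<le> l 1 + l 2 + l 3" "l 1 + l 3 \<le> l 0 + l 2" "l 2 + l 3 \<le> l 0 + l 1"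
  shows "\<exists>P. locc_valid P 4 4 \<and> restores_bell P (mixture 4 4 [X * V])"
proof -
  define Linv where "Linv = mat 4 4 (\<lambda>(i, j). if i = j then complex_of_real (1 / l i) else 0)"
  \<comment> \<open>The inverse of \<open>X\<close>, available explicitly because its Gram matrix is
    diagonal.\<close>
  define Y where "Y = Linv * mat_adjoint X"
  have Linv: "Linv \<in> carrier_mat 4 4" by (simp add: Linv_def)
  have Xd: "mat_adjoint X \<in> carrier_mat 4 4" using X by simp
  have Y: "Y \<in> carrier_mat 4 4" using Linv Xd by (simp add: Y_def)
  have Yd: "mat_adjoint Y \<in> carrier_mat 4 4" using Y by simp
  have XX: "mat_adjoint X * X \<in> carrier_mat 4 4" by (rule mult_carrier_mat[OF Xd X])
  have "Linv * (mat_adjoint X * X) = 1\<^sub>m 4"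
  proof (rule eq_matI, goal_cases)
    case (1 i j)
    then have ij: "i < 4" "j < 4" by simp_all
    have "(Linv * (mat_adjoint X * X)) $$ (i, j)
      = (\<Sum>k<4. if k = i then (if i = j then complex_of_real (1 / l i * l i) else 0) else 0)"
      unfolding index_mult_mat_sum[OF Linv XX ij] unfolding Gram using ij by (intro sum.cong) (auto simp: Linv_def)
    then show ?case using ij pos[of i] pos[of j] by auto
  qed (use Linv X in auto)
  then have YX: "Y * X = 1\<^sub>m 4" by (simp add: Y_def assoc_mult_mat[OF Linv Xd X])
  have XY: "X * Y = 1\<^sub>m 4" by (rule mat_mult_left_right_inverse[OF Y X YX])
  have VV: "transpose_mat V * V = 1\<^sub>m 4"
    by (rule mat_mult_left_right_inverse[OF V _ V_orth]) (use V in simp)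

  \<comment> \<open>The spectrum as a mixture of uniform distributions on pairs: outcome \<open>(q, p, r, p', r')\<close> projects
    onto the eigenvectors \<open>p\<close>, \<open>r\<close> with weight \<open>q\<close>, and \<open>p'\<close>, \<open>r'\<close> are the other two.\<close>
  define qs :: "(real \<times> nat \<times> nat \<times> nat \<times> nat) list" where "qs = [((l 2 - l 1 + l 0 - l 3) / 2, 0, 2, 1, 3), ((l 1 - l 2 + l 0 - l 3) / 2, 0, 1, 2, 3),
    (l 3, 0, 3, 1, 2), ((l 1 + l 2 + l 3 - l 0) / 2, 1, 2, 0, 3)]"
  define S where "S = (\<lambda>(q :: real, p, r, p' :: nat, r' :: nat). select (complex_of_real (sqrt q)) p r)"
  \<comment> \<open>The second operator, for the complementary pair, completes Bob's family; it
    annihilates the state that Alice leaves.\<close>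
  define B where "B = (\<lambda>(q :: real, p, r, p', r'). [select 1 p r * V, select 1 p' r' * V])"
  define I :: instrument where "I = map (\<lambda>t. (2, [S t * Y])) qs"
  define P where "P = Alice I (\<lambda>j. Bob [(2, B (qs ! j))] (\<lambda>_. Done))"
  have qs: "0 \<le> q \<and> p < 4 \<and> r < 4 \<and> p' < 4 \<and> r' < 4 \<and> distinct [p, r, p', r']"
    if "(q, p, r, p', r') \<in> set qs" for q p r p' r'
    using that pos[of 3] ineq by (auto simp: qs_def)
  have S_carr: "S t \<in> carrier_mat 2 4" for t by (auto simp: S_def split: prod.split)
  have I: "is_instrument 4 I"
  proof -
    have "mat_sum 4 (map (\<lambda>S. mat_adjoint S * S) (map S qs))
      = mat_sum 4 (map (\<lambda>(q, p, r, _). mat 4 4 (\<lambda>(i, j). if i = j \<and> i \<in> {p, r} then complex_of_real q else 0)) qs)"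
      unfolding map_map o_def
      by (intro arg_cong[where f = "mat_sum 4"] map_cong refl)
        (use qs in \<open>auto simp: S_def select_Gram simp flip: of_real_mult\<close>)
    also have "\<dots> = mat_adjoint X * X"
    proof (rule eq_matI, goal_cases)
      case (1 i j)
      then have ij: "i < 4" "j < 4" using X by simp_all
      show ?case unfolding Gram
        by (subst mat_sum_index) (use ij nat_less_4_cases[OF ij(1)] in \<open>auto simp: qs_def field_simps\<close>)
    qed (use X in \<open>simp_all add: qs_def\<close>)
    finally have sum: "mat_sum 4 (map (\<lambda>S. mat_adjoint S * S) (map S qs)) = mat_adjoint X * X" .
    have "set (map S qs) \<subseteq> carrier_mat 2 4"
      using S_carr unfolding set_map by blast
    from mat_sum_Gram_mult[OF Y this, unfolded sum]
    have "mat_sum 4 (map (\<lambda>S. mat_adjoint (S * Y) * (S * Y)) (map S qs)) = mat_adjoint Y * (mat_adjoint X * X) * Y" .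
    \<comment> \<open>Regrouping exposes \<open>X * Y\<close> and the adjoint of the same product,
      both equal to the identity.\<close>
    also have "\<dots> = mat_adjoint Y * mat_adjoint X * (X * Y)"
      by (simp only: assoc_mult_mat[OF Yd Xd X, symmetric] assoc_mult_mat[OF mult_carrier_mat[OF Yd Xd] X Y])
    also have "\<dots> = 1\<^sub>m 4"
      by (simp add: XY mat_adjoint_mult[OF X Y, symmetric]) (auto intro!: eq_matI)
    finally show ?thesis
      using S_carr Y by (auto simp: is_instrument_def I_def o_def intro!: mult_carrier_mat)
  qed
  have B: "is_instrument 4 [(2, B t)]" if "t \<in> set qs" for t
  proof -
    obtain q p r p' r' where t: "t = (q, p, r, p', r')" by (cases t)
    note d = qs[OF that[unfolded t]]
    have "mat_sum 4 (map (\<lambda>S. mat_adjoint S * S) [select 1 p r, select 1 p' r']) = 1\<^sub>m 4"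
      using d by (intro eq_matI) (auto simp: select_Gram dest!: nat_less_4_cases)
    then have "mat_sum 4 (map (\<lambda>S. mat_adjoint (S * V) * (S * V)) [select 1 p r, select 1 p' r']) = mat_adjoint V * 1\<^sub>m 4 * V"
      by (subst mat_sum_Gram_mult[OF V, of _ 2]) (simp_all del: list.map)
    \<comment> \<open>Completeness involves the adjoint of \<open>V\<close>, its action on states
      the transpose; they agree since \<open>V\<close> is real.\<close>
    also have "\<dots> = 1\<^sub>m 4" using V by (simp add: V_real VV)
    finally show ?thesis
      using V by (auto simp: is_instrument_def B_def t intro!: mult_carrier_mat)
  qed
  have valid: "locc_valid P 4 4"
    using I B by (auto simp: P_def I_def)
  have branch: "kraus_map 4 (map (\<lambda>K. 1\<^sub>m 2 \<otimes>\<^sub>m K) (B t)) (kraus_map 8 [(S t * Y) \<otimes>\<^sub>m 1\<^sub>m 4] (mixture 4 4 [X * V]))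
      = mixture 2 2 [complex_of_real (sqrt (fst t)) \<cdot>\<^sub>m 1\<^sub>m 2, 0\<^sub>m 2 2]" if "t \<in> set qs" for t
  proof -
    obtain q p r p' r' where t: "t = (q, p, r, p', r')" by (cases t)
    note d = qs[OF that[unfolded t]]
    have XV: "X * V \<in> carrier_mat 4 4" and SY: "S t * Y \<in> carrier_mat 2 4" and SV: "S t * V \<in> carrier_mat 2 4"
      using X V Y S_carr[of t] by auto
    have "S t * Y * (X * V) = S t * V"
      using assoc_mult_mat[OF S_carr Y XV] assoc_mult_mat[OF Y X V] V YX by simp
    then have 1: "kraus_map 8 [(S t * Y) \<otimes>\<^sub>m 1\<^sub>m 4] (mixture 4 4 [X * V]) = mixture 2 4 [S t * V]"
      using kraus_map_Alice[of "[X * V]" 4 4 "[S t * Y]" 2] XV SY by simp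
    have VVS: "S t * V * transpose_mat (select 1 a b * V) = S t * transpose_mat (select 1 a b)" for a b
    proof -
      have s: "select 1 a b \<in> carrier_mat 2 4" and st: "transpose_mat (select 1 a b) \<in> carrier_mat 4 2"
        and Vt: "transpose_mat V \<in> carrier_mat 4 4" using V by simp_all
      have "S t * V * (transpose_mat V * transpose_mat (select 1 a b))
        = S t * (V * transpose_mat V * transpose_mat (select 1 a b))"
        using assoc_mult_mat[OF S_carr V mult_carrier_mat[OF Vt st]] assoc_mult_mat[OF V Vt st] by simp
      then show ?thesis by (simp add: transpose_mult[OF s V] V_orth left_mult_one_mat[OF st])
    qed
    have "S t * transpose_mat (select 1 p r) = complex_of_real (sqrt q) \<cdot>\<^sub>m 1\<^sub>m 2"
      "S t * transpose_mat (select 1 p' r') = 0\<^sub>m 2 2"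
      using d by (auto simp: S_def t select_mult_transpose less_2_cases_iff intro!: eq_matI)
    then have "mixture 2 2 (concat (map (\<lambda>K. map (\<lambda>\<Phi>. \<Phi> * transpose_mat K) [S t * V]) (B t)))
      = mixture 2 2 [complex_of_real (sqrt (fst t)) \<cdot>\<^sub>m 1\<^sub>m 2, 0\<^sub>m 2 2]"
      by (simp add: B_def VVS[unfolded t] t)
    moreover have "set (B t) \<subseteq> carrier_mat 2 4"
      using mult_carrier_mat[OF select_carrier V] by (simp add: B_def t)
    ultimately show ?thesis
      unfolding 1 using kraus_map_Bob[of "[S t * V]" 2 4 "B t" 2] SV by simp
  qed
  have "restores_bell P (mixture 4 4 [X * V])"
    unfolding restores_bell_def
  proof clarify
    fix dA dB \<sigma> assume "(dA, dB, \<sigma>) \<in> locc_branches P 4 4 (mixture 4 4 [X * V])" and tr: "mat_trace \<sigma> \<noteq> 0"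
    then obtain j where "j < length qs" "dA = 2" "dB = 2"
      "\<sigma> = kraus_map 4 (map (\<lambda>K. 1\<^sub>m 2 \<otimes>\<^sub>m K) (B (qs ! j))) (kraus_map 8 [(S (qs ! j) * Y) \<otimes>\<^sub>m 1\<^sub>m 4] (mixture 4 4 [X * V]))"
      by (auto simp: P_def I_def)
    then have d: "dA = 2 * 1" "dB = 2 * 1"
      and \<sigma>: "\<sigma> = mixture 2 2 [complex_of_real (sqrt (fst (qs ! j))) \<cdot>\<^sub>m 1\<^sub>m 2, 0\<^sub>m 2 2]"
      using branch[of "qs ! j"] by auto
    from bell_branch tr d show "\<exists>m n. dA = 2 * m \<and> dB = 2 * n \<and> (1 / mat_trace \<sigma>) \<cdot>\<^sub>m reduced_AB m n \<sigma> = density bell_state"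
      unfolding \<sigma> by blast
  qed
  with valid show ?thesis by blast
qed

section \<open>Sufficiency\<close>

text \<open>The rotation angle is half the argument of \<open>z\<close>. In the basis
  \<open>(x, y)\<close>, \<open>(- y, x)\<close> the symmetric matrix with rows
  \<open>(p, q)\<close> and \<open>(q, r)\<close> becomes diagonal; \<open>\<rho>\<close> is the
  difference of its eigenvalues.\<close>

lemma symmetric_2x2_diagonalize:
  fixes p q r :: real
  obtains x y \<rho> where "x\<^sup>2 + y\<^sup>2 = 1" "0 \<le> \<rho>" "\<rho>\<^sup>2 = (p - r)\<^sup>2 + 4 * q\<^sup>2"
    "p * x\<^sup>2 + 2 * q * x * y + r * y\<^sup>2 = (p + r + \<rho>) / 2"
    "p * y\<^sup>2 - 2 * q * x * y + r * x\<^sup>2 = (p + r - \<rho>) / 2"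
    "q * (x\<^sup>2 - y\<^sup>2) = (p - r) * x * y"
proof -
  define z where "z = Complex (p - r) (2 * q)"
  define \<phi> where "\<phi> = Arg z / 2"
  define x y where "x = cos \<phi>" and "y = sin \<phi>"
  have "z = rcis (cmod z) (2 * \<phi>)" by (simp add: \<phi>_def rcis_cmod_Arg)
  then have "Re z = cmod z * cos (2 * \<phi>)" "Im z = cmod z * sin (2 * \<phi>)"
    by (metis Re_rcis, metis Im_rcis)
  then have pr: "p - r = cmod z * (x\<^sup>2 - y\<^sup>2)" and q: "q = cmod z * (y * x)"
    by (simp_all add: z_def x_def y_def cos_double sin_double)
  have xy: "x\<^sup>2 + y\<^sup>2 = 1" by (simp add: x_def y_def)
  have \<rho>: "(cmod z)\<^sup>2 = (p - r)\<^sup>2 + 4 * q\<^sup>2" by (simp add: cmod_power2 z_def power_mult_distrib)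
  have sq: "(x\<^sup>2 - y\<^sup>2)\<^sup>2 + 4 * (x * y)\<^sup>2 = 1"
  proof -
    have "(x\<^sup>2 - y\<^sup>2)\<^sup>2 + 4 * (x * y)\<^sup>2 = (x\<^sup>2 + y\<^sup>2)\<^sup>2" by (simp add: power2_eq_square algebra_simps)
    then show ?thesis by (simp add: xy)
  qed
  have half: "p * x\<^sup>2 + 2 * q * x * y + r * y\<^sup>2 = (p + r + cmod z) / 2"
  proof -
    have "2 * (p * x\<^sup>2 + 2 * q * x * y + r * y\<^sup>2) = (p + r) * (x\<^sup>2 + y\<^sup>2) + (p - r) * (x\<^sup>2 - y\<^sup>2) + 4 * q * (x * y)"
      by (simp add: algebra_simps)
    also have "\<dots> = p + r + cmod z * ((x\<^sup>2 - y\<^sup>2)\<^sup>2 + 4 * (x * y)\<^sup>2)"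
      unfolding xy pr q by (simp add: power2_eq_square algebra_simps)
    finally show ?thesis unfolding sq by simp
  qed
  have "p * y\<^sup>2 - 2 * q * x * y + r * x\<^sup>2 = (p + r) * (x\<^sup>2 + y\<^sup>2) - (p * x\<^sup>2 + 2 * q * x * y + r * y\<^sup>2)"
    by (simp add: algebra_simps)
  also have "\<dots> = (p + r - cmod z) / 2" unfolding half xy by (simp add: field_simps)
  finally have half': "p * y\<^sup>2 - 2 * q * x * y + r * x\<^sup>2 = (p + r - cmod z) / 2" .
  have "q * (x\<^sup>2 - y\<^sup>2) = (p - r) * x * y" unfolding pr q by (simp add: mult_ac)
  with that[OF xy _ \<rho> half half'] show ?thesis by simp
qed

text \<open>The W part has a Gram matrix of trace \<open>N\<close> and determinant
  \<open>v\<^sup>2 * w\<^sup>2\<close>, hence eigenvalues \<open>(N + \<rho>) / 2\<close> and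
  \<open>(N - \<rho>) / 2\<close>; the Schmidt weights are these times
  \<open>(cos \<theta>)\<^sup>2\<close> and \<open>(sin \<theta>)\<^sup>2\<close>. The largest is at
  most the sum of the others iff \<open>\<rho> \<le> N * (tan \<theta>)\<^sup>2\<close>, which is
  the root of the assumed bound.\<close>

lemma bank_coeff_distillable:
  fixes \<theta> \<alpha> \<beta> \<gamma> a b :: real
  assumes \<theta>: "0 < \<theta>" "\<theta> \<le> pi / 4"
    and nz: "a * \<beta> \<noteq> 0" "a * \<gamma> \<noteq> 0"
    and bound: "((a * \<beta>)\<^sup>2 + (a * \<gamma>)\<^sup>2 + (b * \<alpha>)\<^sup>2)\<^sup>2 * (1 - tan \<theta> ^ 4) \<le> 4 * (a * \<beta>)\<^sup>2 * (a * \<gamma>)\<^sup>2"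
  shows "\<exists>P. locc_valid P 4 4 \<and> restores_bell P (mixture 4 4 [bank_coeff \<theta> \<alpha> \<beta> \<gamma> (complex_of_real a) (complex_of_real b)])"
proof -
  let ?\<Phi> = "bank_coeff \<theta> \<alpha> \<beta> \<gamma> (complex_of_real a) (complex_of_real b)"
  define u v w where "u = b * \<alpha>" and "v = a * \<beta>" and "w = a * \<gamma>"
  define N where "N = v\<^sup>2 + w\<^sup>2 + u\<^sup>2"
  have vw: "v \<noteq> 0" "w \<noteq> 0" using nz by (simp_all add: v_def w_def)
  obtain x y \<rho> where xy: "x\<^sup>2 + y\<^sup>2 = 1" and \<rho>: "0 \<le> \<rho>" "\<rho>\<^sup>2 = (u\<^sup>2 + w\<^sup>2 - v\<^sup>2)\<^sup>2 + 4 * (u * v)\<^sup>2"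
    and eig: "(u\<^sup>2 + w\<^sup>2) * x\<^sup>2 + 2 * (u * v) * x * y + v\<^sup>2 * y\<^sup>2 = (u\<^sup>2 + w\<^sup>2 + v\<^sup>2 + \<rho>) / 2"
      "(u\<^sup>2 + w\<^sup>2) * y\<^sup>2 - 2 * (u * v) * x * y + v\<^sup>2 * x\<^sup>2 = (u\<^sup>2 + w\<^sup>2 + v\<^sup>2 - \<rho>) / 2"
      "u * v * (x\<^sup>2 - y\<^sup>2) = (u\<^sup>2 + w\<^sup>2 - v\<^sup>2) * x * y"
    by (rule symmetric_2x2_diagonalize)
  have N: "u\<^sup>2 + w\<^sup>2 + v\<^sup>2 = N" by (simp add: N_def)
  have \<rho>N: "\<rho>\<^sup>2 = N\<^sup>2 - 4 * v\<^sup>2 * w\<^sup>2"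
    unfolding \<rho>(2) N_def by (simp add: power2_eq_square algebra_simps)
  have N_pos: "0 < N" using vw by (simp add: N_def add_pos_nonneg)
  \<comment> \<open>Nonzero \<open>v\<close> and \<open>w\<close> make the smaller eigenvalue
    positive, so that \<open>X\<close> will be invertible.\<close>
  have \<rho>_less: "\<rho> < N"
  proof (rule power2_less_imp_less)
    have "0 < v\<^sup>2 * w\<^sup>2" using vw by simp
    then show "\<rho>\<^sup>2 < N\<^sup>2" unfolding \<rho>N by linarith
  qed (use N_pos in simp)
  have c: "0 < cos \<theta>" and s: "0 < sin \<theta>"
    using \<theta> by (intro cos_gt_zero_pi sin_gt_zero, auto)+
  have \<rho>_le: "\<rho> \<le> N * (tan \<theta>)\<^sup>2"
  proof (rule power2_le_imp_le)
    have "(N * (tan \<theta>)\<^sup>2)\<^sup>2 = N\<^sup>2 * tan \<theta> ^ 4" by (simp add: power_mult_distrib flip: power_mult)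
    then show "\<rho>\<^sup>2 \<le> (N * (tan \<theta>)\<^sup>2)\<^sup>2"
      using bound unfolding \<rho>N u_def[symmetric] v_def[symmetric] w_def[symmetric] N_def[symmetric]
      by (simp add: algebra_simps)
  qed (use N_pos in simp)
  have "(cos \<theta>)\<^sup>2 * \<rho> \<le> (cos \<theta>)\<^sup>2 * (N * (tan \<theta>)\<^sup>2)" by (rule mult_left_mono[OF \<rho>_le]) simp
  also have "\<dots> = N * (sin \<theta>)\<^sup>2" using c by (simp add: tan_def power_divide)
  finally have c\<rho>: "(cos \<theta>)\<^sup>2 * \<rho> \<le> N * (sin \<theta>)\<^sup>2" .
  have sc: "(sin \<theta>)\<^sup>2 \<le> (cos \<theta>)\<^sup>2"
  proof -
    have "0 \<le> cos (2 * \<theta>)" using \<theta> by (intro cos_ge_zero) auto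
    then show ?thesis by (simp add: cos_double)
  qed
  \<comment> \<open>The block with rows \<open>(u, v)\<close> and \<open>(w, 0)\<close>, expressed
    in the eigenbasis of its Gram matrix, so that its columns are orthogonal. \<open>X\<close> holds
    one copy weighted by \<open>cos \<theta>\<close> and one by \<open>sin \<theta>\<close>.\<close>
  define h where "h i j = (if i = 0 then if j = 0 then u * x + v * y else v * x - u * y
    else if j = 0 then w * x else - w * y)" for i j :: nat
  define X where "X = mat 4 4 (\<lambda>(i, j). if i div 2 = j div 2
      then complex_of_real ((if i < 2 then cos \<theta> else sin \<theta>) * h (i mod 2) (j mod 2)) else 0)"
  define V where "V = mat 4 4 (\<lambda>(i, j). if i div 2 = j div 2
      then complex_of_real (if i mod 2 = 0 then if j mod 2 = 0 then x else y else if j mod 2 = 0 then - y else x) else 0)"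
  define l where "l i = (if i < 2 then (cos \<theta>)\<^sup>2 else (sin \<theta>)\<^sup>2) * ((if i mod 2 = 0 then N + \<rho> else N - \<rho>) / 2)" for i :: nat
  have X: "X \<in> carrier_mat 4 4" and V: "V \<in> carrier_mat 4 4" by (simp_all add: X_def V_def)
  have Xd: "mat_adjoint X \<in> carrier_mat 4 4" and Vt: "transpose_mat V \<in> carrier_mat 4 4" using X V by simp_all
  have VV: "V * transpose_mat V = 1\<^sub>m 4"
  proof (rule eq_matI, goal_cases)
    case (1 i j)
    then have ij: "i < 4" "j < 4" by simp_all
    show ?case unfolding index_mult_mat_sum[OF V Vt ij] sum_lessThan_4
      using nat_less_4_cases[OF ij(1)] nat_less_4_cases[OF ij(2)] xy
      by (elim disjE) (simp_all add: V_def power2_eq_square add.commute flip: of_real_mult of_real_add)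
  qed (use V in simp_all)
  have XV: "X * V = ?\<Phi>"
  proof (rule eq_matI, goal_cases)
    case (1 i j)
    then have ij: "i < 4" "j < 4" by simp_all
    have e: "(u * x + v * y) * x - (v * x - u * y) * y = u" "(u * x + v * y) * y + (v * x - u * y) * x = v"
      "w * x * x + w * y * y = w"
    proof -
      have "(u * x + v * y) * x - (v * x - u * y) * y = u * (x\<^sup>2 + y\<^sup>2)" by (simp add: power2_eq_square algebra_simps)
      then show "(u * x + v * y) * x - (v * x - u * y) * y = u" by (simp add: xy)
      have "(u * x + v * y) * y + (v * x - u * y) * x = v * (x\<^sup>2 + y\<^sup>2)" by (simp add: power2_eq_square algebra_simps)
      then show "(u * x + v * y) * y + (v * x - u * y) * x = v" by (simp add: xy)
      have "w * x * x + w * y * y = w * (x\<^sup>2 + y\<^sup>2)" by (simp add: power2_eq_square algebra_simps)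
      then show "w * x * x + w * y * y = w" by (simp add: xy)
    qed
    have "(X * V) $$ (i, j) = (if i div 2 = j div 2 then complex_of_real ((if i < 2 then cos \<theta> else sin \<theta>) *
        (if i mod 2 = 0 then if j mod 2 = 0 then (u * x + v * y) * x - (v * x - u * y) * y else (u * x + v * y) * y + (v * x - u * y) * x
         else if j mod 2 = 0 then w * x * x + w * y * y else 0)) else 0)"
      unfolding index_mult_mat_sum[OF X V ij] sum_lessThan_4
      using nat_less_4_cases[OF ij(1)] nat_less_4_cases[OF ij(2)]
      by (elim disjE) (simp_all add: X_def V_def h_def algebra_simps)
    also have "\<dots> = ?\<Phi> $$ (i, j)"
      unfolding e using nat_less_4_cases[OF ij(1)] nat_less_4_cases[OF ij(2)]
      by (elim disjE) (simp_all add: bank_coeff_def kron_def link_coeff_def W_coeff_def u_def v_def w_def)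
    finally show ?case .
  qed (use X V in simp_all)
  have h: "h 0 0 * h 0 0 + h 1 0 * h 1 0 = (N + \<rho>) / 2" "h 0 1 * h 0 1 + h 1 1 * h 1 1 = (N - \<rho>) / 2"
    "h 0 0 * h 0 1 + h 1 0 * h 1 1 = 0" "h 0 1 * h 0 0 + h 1 1 * h 1 0 = 0"
    using eig unfolding N by (simp_all add: h_def power2_eq_square algebra_simps)
  have Gram: "mat_adjoint X * X = mat 4 4 (\<lambda>(i, j). if i = j then complex_of_real (l i) else 0)"
  proof (rule eq_matI, goal_cases)
    case (1 i j)
    then have ij: "i < 4" "j < 4" by simp_all
    have "(mat_adjoint X * X) $$ (i, j) = (if i div 2 = j div 2 then complex_of_real ((if i < 2 then (cos \<theta>)\<^sup>2 else (sin \<theta>)\<^sup>2) *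
        (h 0 (i mod 2) * h 0 (j mod 2) + h 1 (i mod 2) * h 1 (j mod 2))) else 0)"
      unfolding index_mult_mat_sum[OF Xd X ij] sum_lessThan_4
      using nat_less_4_cases[OF ij(1)] nat_less_4_cases[OF ij(2)]
      by (elim disjE) (simp_all add: X_def power2_eq_square algebra_simps del: One_nat_def)
    also have "\<dots> = (if i = j then complex_of_real (l i) else 0)"
      using nat_less_4_cases[OF ij(1)] nat_less_4_cases[OF ij(2)]
      by (elim disjE) (simp_all add: l_def h del: One_nat_def of_real_mult of_real_add)
    finally show ?case using ij by simp
  qed (use X in simp_all)
  have V_real: "mat_adjoint V = transpose_mat V"
    by (rule eq_matI) (auto simp: V_def)
  have pos: "0 < l i" for i
    using c s \<rho>(1) \<rho>_less by (auto simp: l_def)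
  have "l 1 + l 3 \<le> l 0 + l 2"
    using \<rho>(1) by (simp add: l_def add_mono mult_left_mono)
  moreover have "l 2 + l 3 \<le> l 0 + l 1"
    using mult_right_mono[OF sc, of N] N_pos by (simp add: l_def field_simps)
  \<comment> \<open>The inequality that carries the assumed bound; the two before it compare
    eigenvalues and link weights.\<close>
  moreover have "l 0 \<le> l 1 + l 2 + l 3"
    using c\<rho> by (simp add: l_def field_simps)
  ultimately show ?thesis
    using distillable[OF X V V_real VV Gram pos] unfolding XV by blast
qed

text \<open>The Bank's operators in \<open>bound_imp_restorable\<close> have a zero row; its
  component is dropped here.\<close>

lemma mixture_zero:
  assumes "\<Phi> \<in> carrier_mat m n"
  shows "mixture m n [\<Phi>, 0\<^sub>m m n] = mixture m n [\<Phi>]"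
proof (rule eq_matI)
  have carr: "set [\<Phi>, 0\<^sub>m m n] \<subseteq> carrier_mat m n" "set [\<Phi>] \<subseteq> carrier_mat m n" using assms by auto
  note mc = mixture_carrier[OF carr(1)] mixture_carrier[OF carr(2)]
  show "dim_row (mixture m n [\<Phi>, 0\<^sub>m m n]) = dim_row (mixture m n [\<Phi>])"
    "dim_col (mixture m n [\<Phi>, 0\<^sub>m m n]) = dim_col (mixture m n [\<Phi>])" using mc by auto
  fix i j assume "i < dim_row (mixture m n [\<Phi>])" "j < dim_col (mixture m n [\<Phi>])"
  then have ij: "i < m * n" "j < m * n" using mc by auto
  then show "mixture m n [\<Phi>, 0\<^sub>m m n] $$ (i, j) = mixture m n [\<Phi>] $$ (i, j)"
    unfolding mixture_index[OF carr(1) ij] mixture_index[OF carr(2) ij]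
    by (simp add: div_less_of_less_mult mod_less_of_less_mult)
qed

text \<open>Both Bank amplitudes have modulus \<open>1 / sqrt 2\<close>, so each outcome has weight
  1/2 and the condition of \<open>bank_coeff_distillable\<close> is the assumed bound scaled by 1/4.
  The sign \<open>t\<close> enters it only squared, so one argument serves both outcomes.\<close>

lemma bound_imp_restorable:
  fixes \<theta> \<alpha> \<beta> \<gamma> :: real
  assumes \<theta>: "0 < \<theta>" "\<theta> \<le> pi / 4"
    and pos: "\<beta> > 0" "\<gamma> > 0"
    and norm: "\<alpha>\<^sup>2 + \<beta>\<^sup>2 + \<gamma>\<^sup>2 = 1"
    and bound: "1 - tan \<theta> ^ 4 \<le> 4 * \<beta>\<^sup>2 * \<gamma>\<^sup>2"
  shows "bank_measures_restorable (link_state \<theta>) (W_state \<alpha> \<beta> \<gamma>)"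
proof -
  \<comment> \<open>\<open>M 1 = |0\<rangle>\<langle>+|\<close> and \<open>M (-1) = |0\<rangle>\<langle>-|\<close>.\<close>
  define M where "M t = mat 2 2 (\<lambda>(i, j). if i = 0 then complex_of_real (if j = 0 then 1 / sqrt 2 else t / sqrt 2) else 0)" for t
  have M: "M t \<in> carrier_mat 2 2" for t by (simp add: M_def)
  have meas: "is_measurement 2 [M 1, M (- 1)]"
    unfolding is_measurement_def
  proof
    show "\<forall>N\<in>set [M 1, M (- 1)]. N \<in> carrier_mat 2 2" using M by simp
    have "mat_adjoint (M t) * M t = mat 2 2 (\<lambda>(i, j). complex_of_real (if i = j then t\<^sup>2 / 2 else t / 2))"
      if "t\<^sup>2 = 1" for t
    proof (rule eq_matI, goal_cases)
      case (1 i j)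
      then have ij: "i < 2" "j < 2" by simp_all
      show ?case unfolding index_mult_mat_sum[OF mat_adjoint_carrier[OF M] M ij]
        using ij that by (auto simp: M_def numeral_2_eq_2 less_Suc_eq power2_eq_square simp flip: of_real_mult)
    qed (simp_all add: M_def)
    then show "mat_sum 2 (map (\<lambda>M. mat_adjoint M * M) [M 1, M (- 1)]) = 1\<^sub>m 2"
      by (intro eq_matI) auto
  qed
  have "\<exists>P. locc_valid P 4 4 \<and> restores_bell P (bank_outcome_state (M t) (density (global_state (link_state \<theta>) (W_state \<alpha> \<beta> \<gamma>))))"
    if "t\<^sup>2 = 1" for t
  proof -
    have zero: "bank_coeff \<theta> \<alpha> \<beta> \<gamma> 0 0 = 0\<^sub>m 4 4"
      by (rule eq_matI) (auto simp: bank_coeff_def kron_def link_coeff_def W_coeff_def less_mult_imp_div_less)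
    have "bank_outcome_state (M t) (density (global_state (link_state \<theta>) (W_state \<alpha> \<beta> \<gamma>)))
      = mixture 4 4 [bank_coeff \<theta> \<alpha> \<beta> \<gamma> (complex_of_real (1 / sqrt 2)) (complex_of_real (t / sqrt 2))]"
      unfolding bank_outcome_state_eq[OF M] mixture_zero[OF bank_coeff_carrier, symmetric]
      by (simp add: M_def zero)
    moreover have "\<exists>P. locc_valid P 4 4 \<and> restores_bell P
      (mixture 4 4 [bank_coeff \<theta> \<alpha> \<beta> \<gamma> (complex_of_real (1 / sqrt 2)) (complex_of_real (t / sqrt 2))])"
    proof (rule bank_coeff_distillable[OF \<theta>])
      have amp: "(1 / sqrt 2 * \<beta>)\<^sup>2 + (1 / sqrt 2 * \<gamma>)\<^sup>2 + (t / sqrt 2 * \<alpha>)\<^sup>2 = (\<alpha>\<^sup>2 + \<beta>\<^sup>2 + \<gamma>\<^sup>2) / 2"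
        using that by (simp add: power_mult_distrib power_divide)
      show "((1 / sqrt 2 * \<beta>)\<^sup>2 + (1 / sqrt 2 * \<gamma>)\<^sup>2 + (t / sqrt 2 * \<alpha>)\<^sup>2)\<^sup>2 * (1 - tan \<theta> ^ 4)
        \<le> 4 * (1 / sqrt 2 * \<beta>)\<^sup>2 * (1 / sqrt 2 * \<gamma>)\<^sup>2"
        unfolding amp norm using bound by (simp add: power_mult_distrib power_divide)
    qed (use pos in auto)
    ultimately show ?thesis by simp
  qed
  from this[of 1] this[of "- 1"] obtain P P' where
    "locc_valid P 4 4 \<and> restores_bell P (bank_outcome_state (M 1) (density (global_state (link_state \<theta>) (W_state \<alpha> \<beta> \<gamma>))))"
    "locc_valid P' 4 4 \<and> restores_bell P' (bank_outcome_state (M (- 1)) (density (global_state (link_state \<theta>) (W_state \<alpha> \<beta> \<gamma>))))"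
    by auto
  then have "\<forall>k<length [M 1, M (- 1)]. locc_valid (if k = 0 then P else P') 4 4 \<and>
    restores_bell (if k = 0 then P else P') (bank_outcome_state ([M 1, M (- 1)] ! k) (density (global_state (link_state \<theta>) (W_state \<alpha> \<beta> \<gamma>))))"
    by (simp add: less_Suc_eq numeral_2_eq_2)
  then show ?thesis
    unfolding bank_measures_restorable_def
    by (intro exI[of _ "[M 1, M (- 1)]"] exI[of _ "\<lambda>k. if k = 0 then P else P'"] conjI meas)
qed

theorem theorem4:
  fixes \<theta> \<alpha> \<beta> \<gamma> :: real
  assumes "0 < \<theta>" and "\<theta> \<le> pi / 4"
    and "\<alpha> > 0" and "\<beta> > 0" and "\<gamma> > 0"
    and "\<alpha>\<^sup>2 + \<beta>\<^sup>2 + \<gamma>\<^sup>2 = 1"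
  shows "bank_measures_restorable (link_state \<theta>) (W_state \<alpha> \<beta> \<gamma>) \<longleftrightarrow>
    4 * \<beta>\<^sup>2 * \<gamma>\<^sup>2 \<ge> 1 - tan \<theta> ^ 4"
  using restorable_imp_bound[of \<theta> \<beta> \<gamma> \<alpha>] bound_imp_restorable[of \<theta> \<beta> \<gamma> \<alpha>] assms by blast

end
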